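(* Let $G$ be a periodic group with set of minimal subgroups $\Omega_G=\{H_i\}_{i\in I}$, such that $H_iH_j=H_jH_i$ for all $H_i,H_j\in\Omega_G$ and $|\Omega_G|\ge2$. Let $H_r\in\Omega_G$ and let $\{\Gamma_j\}_{j\in J}$ be the set of all connected components of the graph $\Gamma(H_r)$. Let $\eta:G\to\Sigma(\mathcal K_1(G))$ be the map $\eta(a)=\{Ka\mid 1\ne K\le G\}$. Then $\eta$ is an isomorphism from $G$ to $\Sigma(\mathcal K_1(G))$ if and only if $|J|=1$.
   Context: For $K\le G$, $g\in G$ write $K^g=g^{-1}Kg$. $\mathcal K_1(G)$ is the set of all right cosets $Ha$ of all non-trivial subgroups $H$ of $G$ with operation $Ha*Kb=\langle H,K^{a^{-1}}\rangle ab$; it is an inverse semigroup whose idempotents are the non-trivial subgroups of $G$, with natural partial order $Ha\le_n Kb\iff Kb\subseteq Ha$. In an inverse semigroup $S$, elements $x,y$ are compatible if $xy^{-1}$ and $x^{-1}y$ are both idempotents. A subset of $S$ is permissible if its elements are pairwise compatible and it is an order ideal (down-set) for the natural partial order. The completion $C(S)$ is the set of all permissible subsets of $S$ under the usual multiplication of subsets; it is an inverse monoid with identity $E(S)$ (the set of idempotents of $S$). $\Sigma(S)$ denotes the group of units of $C(S)$. The map $\eta$ takes values in $\Sigma(\mathcal K_1(G))$. Minimal subgroup means minimal non-trivial subgroup. $\Gamma(H_r)$ is the simple graph with vertex set $V_{H_r}=\Omega_G\setminus\{H_r\}$ and edge set $E_{H_r}=\{(H_i,H_j)\mid H_i\ne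 H_j,\ H_iH_j\cap H_r=1\}$ (with $H_i,H_j\in V_{H_r}$). *)

theory Defs
  imports
    "HOL-Algebra.Generated_Groups"
    "Graph_Theory.Graph_Theory"
begin

section \<open>Inverse semigroups and their completions\<close>

text \<open>
  A semigroup is given by a carrier set \<open>S\<close> and a binary operation \<open>m\<close>: the semigroup of
  cosets below has in general no identity, so it is not a \<^typ>\<open>'s monoid\<close> record.
\<close>

definition inverse_semigroup :: "'s set \<Rightarrow> ('s \<Rightarrow> 's \<Rightarrow> 's) \<Rightarrow> bool" where
  "inverse_semigroup S m \<longleftrightarrow>
     (\<forall>x\<in>S. \<forall>y\<in>S. m x y \<in> S) \<and>
     (\<forall>x\<in>S. \<forall>y\<in>S. \<forall>z\<in>S. m (m x y) z = m x (m y z)) \<and>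
     (\<forall>x\<in>S. \<exists>!y. y \<in> S \<and> m (m x y) x = x \<and> m (m y x) y = y)"

definition semigroup_inv :: "'s set \<Rightarrow> ('s \<Rightarrow> 's \<Rightarrow> 's) \<Rightarrow> 's \<Rightarrow> 's" where
  "semigroup_inv S m x = (THE y. y \<in> S \<and> m (m x y) x = x \<and> m (m y x) y = y)"

definition idempotents :: "'s set \<Rightarrow> ('s \<Rightarrow> 's \<Rightarrow> 's) \<Rightarrow> 's set" where
  "idempotents S m = {e \<in> S. m e e = e}"

definition natural_le :: "'s set \<Rightarrow> ('s \<Rightarrow> 's \<Rightarrow> 's) \<Rightarrow> 's \<Rightarrow> 's \<Rightarrow> bool" where
  "natural_le S m x y \<longleftrightarrow> (\<exists>e\<in>idempotents S m. x = m e y)"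

definition compatible_elems :: "'s set \<Rightarrow> ('s \<Rightarrow> 's \<Rightarrow> 's) \<Rightarrow> 's \<Rightarrow> 's \<Rightarrow> bool" where
  "compatible_elems S m x y \<longleftrightarrow>
     m x (semigroup_inv S m y) \<in> idempotents S m \<and> m (semigroup_inv S m x) y \<in> idempotents S m"

definition permissible :: "'s set \<Rightarrow> ('s \<Rightarrow> 's \<Rightarrow> 's) \<Rightarrow> 's set \<Rightarrow> bool" where
  "permissible S m A \<longleftrightarrow>
     A \<subseteq> S \<and>
     (\<forall>x\<in>A. \<forall>y\<in>A. compatible_elems S m x y) \<and>
     (\<forall>y\<in>A. \<forall>x\<in>S. natural_le S m x y \<longrightarrow> x \<in> A)"

definition completion :: "'s set \<Rightarrow> ('s \<Rightarrow> 's \<Rightarrow> 's) \<Rightarrow> 's set monoid" where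
  "completion S m =
     \<lparr>carrier = {A. permissible S m A},
      monoid.mult = (\<lambda>A B. {m x y | x y. x \<in> A \<and> y \<in> B}),
      monoid.one = idempotents S m\<rparr>"

definition completion_units :: "'s set \<Rightarrow> ('s \<Rightarrow> 's \<Rightarrow> 's) \<Rightarrow> 's set monoid" where
  "completion_units S m = units_of (completion S m)"


section \<open>The inverse semigroup of cosets of non-trivial subgroups\<close>

definition nontrivial_subgroup :: "('a, 'b) monoid_scheme \<Rightarrow> 'a set \<Rightarrow> bool" where
  "nontrivial_subgroup G H \<longleftrightarrow> subgroup H G \<and> H \<noteq> {\<one>\<^bsub>G\<^esub>}"

definition conj_set :: "('a, 'b) monoid_scheme \<Rightarrow> 'a set \<Rightarrow> 'a \<Rightarrow> 'a set" where
  "conj_set G K g = (\<lambda>k. inv\<^bsub>G\<^esub> g \<otimes>\<^bsub>G\<^esub> k \<otimes>\<^bsub>G\<^esub> g) ` K"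

definition K1 :: "('a, 'b) monoid_scheme \<Rightarrow> 'a set set" where
  "K1 G = {H #>\<^bsub>G\<^esub> a | H a. nontrivial_subgroup G H \<and> a \<in> carrier G}"

text \<open>
  The product is defined through arbitrary coset representatives; it does not depend on
  them, see \<open>K1_mult_rcos\<close> below.
\<close>

definition K1_mult :: "('a, 'b) monoid_scheme \<Rightarrow> 'a set \<Rightarrow> 'a set \<Rightarrow> 'a set" where
  "K1_mult G A B =
     (THE C. \<exists>H K a b. nontrivial_subgroup G H \<and> nontrivial_subgroup G K \<and>
        a \<in> carrier G \<and> b \<in> carrier G \<and> A = H #>\<^bsub>G\<^esub> a \<and> B = K #>\<^bsub>G\<^esub> b \<and>
        C = generate G (H \<union> conj_set G K (inv\<^bsub>G\<^esub> a)) #>\<^bsub>G\<^esub> (a \<otimes>\<^bsub>G\<^esub> b))"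

definition eta :: "('a, 'b) monoid_scheme \<Rightarrow> 'a \<Rightarrow> 'a set set" where
  "eta G a = {K #>\<^bsub>G\<^esub> a | K. nontrivial_subgroup G K}"


section \<open>Minimal subgroups and their graph\<close>

definition periodic_group :: "('a, 'b) monoid_scheme \<Rightarrow> bool" where
  "periodic_group G \<longleftrightarrow>
     group G \<and> (\<forall>a\<in>carrier G. \<exists>n::nat. n > 0 \<and> a [^]\<^bsub>G\<^esub> n = \<one>\<^bsub>G\<^esub>)"

definition minimal_subgroups :: "('a, 'b) monoid_scheme \<Rightarrow> 'a set set" where
  "minimal_subgroups G =
     {H. nontrivial_subgroup G H \<and> (\<forall>K. nontrivial_subgroup G K \<and> K \<subseteq> H \<longrightarrow> K = H)}"

definition minsub_graph :: "('a, 'b) monoid_scheme \<Rightarrow> 'a set \<Rightarrow> 'a set pair_pre_digraph" where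
  "minsub_graph G Hr =
     \<lparr>pverts = minimal_subgroups G - {Hr},
      parcs = {(H, K). H \<in> minimal_subgroups G - {Hr} \<and> K \<in> minimal_subgroups G - {Hr} \<and>
                 H \<noteq> K \<and> (H <#>\<^bsub>G\<^esub> K) \<inter> Hr = {\<one>\<^bsub>G\<^esub>}}\<rparr>"

text \<open>
  Undirected graphs are symmetric digraphs; for those the connected components are the
  strongly connected components. Symmetry of \<^const>\<open>minsub_graph\<close> holds as soon as minimal
  subgroups permute, see \<open>minsub_graph_symmetric\<close> below.
\<close>

definition connected_components :: "'v pair_pre_digraph \<Rightarrow> ('v, 'v \<times> 'v) pre_digraph set" where
  "connected_components \<Gamma> = pre_digraph.sccs (with_proj \<Gamma>)"

lemma minsub_graph_symmetric:
  assumes "\<forall>H\<in>minimal_subgroups G. \<forall>K\<in>minimal_subgroups G. H <#>\<^bsub>G\<^esub> K = K <#>\<^bsub>G\<^esub> H"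
  shows "pair_bidirected_digraph (minsub_graph G Hr)"
proof unfold_locales
  show "symmetric (with_proj (minsub_graph G Hr))"
    unfolding symmetric_def
  proof (rule symI)
    fix H K assume "(H, K) \<in> arcs_ends (with_proj (minsub_graph G Hr))"
    then have HK: "H \<in> minimal_subgroups G - {Hr}" "K \<in> minimal_subgroups G - {Hr}" "H \<noteq> K"
      "(H <#>\<^bsub>G\<^esub> K) \<inter> Hr = {\<one>\<^bsub>G\<^esub>}"
      unfolding minsub_graph_def by simp_all
    have "H <#>\<^bsub>G\<^esub> K = K <#>\<^bsub>G\<^esub> H"
      using assms HK(1,2) by blast
    then have "(K <#>\<^bsub>G\<^esub> H) \<inter> Hr = {\<one>\<^bsub>G\<^esub>}" by (rule subst) (rule HK(4))
    then have "(K, H) \<in> parcs (minsub_graph G Hr)"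
      unfolding minsub_graph_def using HK(1,2) HK(3)[symmetric] by simp
    then show "(K, H) \<in> arcs_ends (with_proj (minsub_graph G Hr))" by simp
  qed
qed (simp_all add: minsub_graph_def case_prod_beta)


section \<open>Consistency of the definitions\<close>

lemma (in group) cancel:
  assumes "x \<in> carrier G" "y \<in> carrier G"
  shows "x \<otimes> (inv x \<otimes> y) = y" and "inv x \<otimes> (x \<otimes> y) = y"
  using assms by (simp_all add: m_assoc[symmetric])

lemma (in group) conj_set_subgroup:
  assumes "subgroup K G" "a \<in> carrier G"
  shows "subgroup (conj_set G K a) G"
proof (rule subgroupI)
  note K = subgroup.subset[OF assms(1)]
  show "conj_set G K a \<subseteq> carrier G"
    using K assms(2) by (auto simp: conj_set_def)
  show "conj_set G K a \<noteq> {}"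
    using subgroup.one_closed[OF assms(1)] by (auto simp: conj_set_def)
  fix x assume "x \<in> conj_set G K a"
  then obtain k where k: "k \<in> K" "x = inv a \<otimes> k \<otimes> a" by (auto simp: conj_set_def)
  have "inv x = inv a \<otimes> inv k \<otimes> a"
    using k K assms(2) by (auto simp: inv_mult_group m_assoc subset_iff)
  then show "inv x \<in> conj_set G K a"
    using subgroup.m_inv_closed[OF assms(1) k(1)] by (auto simp: conj_set_def)
  fix y assume "y \<in> conj_set G K a"
  then obtain l where l: "l \<in> K" "y = inv a \<otimes> l \<otimes> a" by (auto simp: conj_set_def)
  have kl: "k \<in> carrier G" "l \<in> carrier G" using k l K by auto
  have "x \<otimes> y = inv a \<otimes> k \<otimes> (a \<otimes> inv a) \<otimes> l \<otimes> a"
    using kl assms(2) k(2) l(2) by (simp add: m_assoc cancel del: r_inv l_inv)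
  also have "\<dots> = inv a \<otimes> (k \<otimes> l) \<otimes> a"
    using kl assms(2) by (simp add: m_assoc cancel)
  finally show "x \<otimes> y \<in> conj_set G K a"
    using subgroup.m_closed[OF assms(1) k(1) l(1)] by (auto simp: conj_set_def)
qed

lemma (in group) mem_conj_set:
  assumes "K \<subseteq> carrier G" "a \<in> carrier G"
  shows "x \<in> conj_set G K a \<longleftrightarrow> x \<in> carrier G \<and> a \<otimes> x \<otimes> inv a \<in> K"
proof
  assume "x \<in> conj_set G K a"
  then obtain k where k: "k \<in> K" "x = inv a \<otimes> k \<otimes> a" by (auto simp: conj_set_def)
  have "k \<in> carrier G" using k assms by auto
  then have "a \<otimes> x \<otimes> inv a = k" "x \<in> carrier G"
    using k(2) assms(2) by (simp_all add: m_assoc cancel)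
  then show "x \<in> carrier G \<and> a \<otimes> x \<otimes> inv a \<in> K" using k by simp
next
  assume x: "x \<in> carrier G \<and> a \<otimes> x \<otimes> inv a \<in> K"
  have "x = inv a \<otimes> (a \<otimes> x \<otimes> inv a) \<otimes> a"
    using x assms(2) by (simp add: m_assoc cancel)
  then show "x \<in> conj_set G K a" using x unfolding conj_set_def by blast
qed

lemma (in group) mem_rcos:
  assumes "H \<subseteq> carrier G" "a \<in> carrier G"
  shows "x \<in> H #> a \<longleftrightarrow> x \<in> carrier G \<and> x \<otimes> inv a \<in> H"
proof
  assume "x \<in> H #> a"
  then obtain h where h: "h \<in> H" "x = h \<otimes> a" by (auto simp: r_coset_def)
  have "h \<in> carrier G" using h assms by auto
  then show "x \<in> carrier G \<and> x \<otimes> inv a \<in> H"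
    using h assms(2) by (simp add: m_assoc cancel)
next
  assume x: "x \<in> carrier G \<and> x \<otimes> inv a \<in> H"
  have "x = (x \<otimes> inv a) \<otimes> a" using x assms(2) by (simp add: m_assoc cancel)
  then show "x \<in> H #> a" using x unfolding r_coset_def by blast
qed

lemma (in group) rcos_eq_iff:
  assumes "subgroup H G" "subgroup K G" "a \<in> carrier G" "b \<in> carrier G"
  shows "H #> a = K #> b \<longleftrightarrow> H = K \<and> a \<otimes> inv b \<in> H"
proof
  assume eq: "H #> a = K #> b"
  note c = subgroup.subset[OF assms(1)] subgroup.subset[OF assms(2)]
  have "a \<in> K #> b" using eq assms(1,3) rcos_self by blast
  then have ab: "a \<otimes> inv b \<in> K" using mem_rcos[OF c(2) assms(4)] by simp
  have "K #> a = K #> b"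
    using repr_independence[OF \<open>a \<in> K #> b\<close> assms(4,2)] by simp
  then have "H #> a = K #> a" using eq by simp
  then have "x \<otimes> a \<otimes> inv a \<in> H \<longleftrightarrow> x \<otimes> a \<otimes> inv a \<in> K" if "x \<in> carrier G" for x
    using mem_rcos[OF c(1) assms(3)] mem_rcos[OF c(2) assms(3)] that assms(3) by blast
  then have "x \<in> H \<longleftrightarrow> x \<in> K" if "x \<in> carrier G" for x
    using that assms(3) by (simp add: m_assoc cancel)
  then have "H = K" using c by blast
  then show "H = K \<and> a \<otimes> inv b \<in> H" using ab by simp
next
  assume H: "H = K \<and> a \<otimes> inv b \<in> H"
  then have "a \<in> K #> b" using mem_rcos[OF subgroup.subset[OF assms(2)] assms(4)] assms(3) by auto
  then show "H #> a = K #> b" using repr_independence[OF _ assms(4,2)] H by auto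
qed

text \<open>
  The product of two cosets is the least coset containing their setwise product. All
  properties of the operation follow from this.
\<close>

lemma (in group) K1_product_least:
  assumes H: "subgroup H G" and K: "subgroup K G" and a: "a \<in> carrier G" and b: "b \<in> carrier G"
    and L: "subgroup L G" and c: "c \<in> carrier G"
  shows "generate G (H \<union> conj_set G K (inv a)) #> (a \<otimes> b) \<subseteq> L #> c
    \<longleftrightarrow> (H #> a) <#> (K #> b) \<subseteq> L #> c"
proof -
  let ?P = "H \<union> conj_set G K (inv a)"
  have Hc: "H \<subseteq> carrier G" and Kc: "K \<subseteq> carrier G" and Lc: "L \<subseteq> carrier G"
    using H K L subgroup.subset by auto
  have Pc: "?P \<subseteq> carrier G"
    using Hc subgroup.subset[OF conj_set_subgroup[OF K]] a by auto
  have gs: "subgroup (generate G ?P) G" using generate_is_subgroup[OF Pc] .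
  show ?thesis
  proof
    assume sub: "generate G ?P #> (a \<otimes> b) \<subseteq> L #> c"
    have "(h \<otimes> a) \<otimes> (k \<otimes> b) \<in> generate G ?P #> (a \<otimes> b)" if "h \<in> H" "k \<in> K" for h k
    proof -
      have hk: "h \<in> carrier G" "k \<in> carrier G" using that Hc Kc by auto
      have "(h \<otimes> a) \<otimes> (k \<otimes> b) = (h \<otimes> (a \<otimes> k \<otimes> inv a)) \<otimes> (a \<otimes> b)"
        using hk a b by (simp add: m_assoc cancel)
      moreover have "a \<otimes> k \<otimes> inv a \<in> conj_set G K (inv a)"
        using that a by (auto simp: conj_set_def)
      then have "h \<otimes> (a \<otimes> k \<otimes> inv a) \<in> generate G ?P"
        using that by (intro generate.eng[of h _ _ "a \<otimes> k \<otimes> inv a"] generate.incl) auto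
      ultimately show ?thesis unfolding r_coset_def by auto
    qed
    then show "(H #> a) <#> (K #> b) \<subseteq> L #> c"
      using sub unfolding set_mult_def r_coset_def by blast
  next
    assume sub: "(H #> a) <#> (K #> b) \<subseteq> L #> c"
    have prod: "(h \<otimes> a) \<otimes> (k \<otimes> b) \<in> L #> c" if "h \<in> H" "k \<in> K" for h k
      using sub that unfolding set_mult_def r_coset_def by blast
    have one: "\<one> \<in> H" "\<one> \<in> K" using H K subgroup.one_closed by auto
    have "a \<otimes> b \<in> L #> c" using prod[OF one] a b by simp
    then have Leq: "L #> c = L #> (a \<otimes> b)"
      using repr_independence[OF _ c L] by blast
    have ab: "a \<otimes> b \<in> carrier G" using a b by simp
    have in_L: "h \<otimes> (a \<otimes> k \<otimes> inv a) \<in> L" if "h \<in> H" "k \<in> K" for h k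
    proof -
      have hk: "h \<in> carrier G" "k \<in> carrier G" using that Hc Kc by auto
      have "(h \<otimes> a) \<otimes> (k \<otimes> b) \<otimes> inv (a \<otimes> b) \<in> L"
        using prod[OF that] Leq mem_rcos[OF Lc ab] by simp
      moreover have "(h \<otimes> a) \<otimes> (k \<otimes> b) \<otimes> inv (a \<otimes> b) = h \<otimes> (a \<otimes> k \<otimes> (b \<otimes> inv b) \<otimes> inv a)"
        using hk a b by (simp add: m_assoc cancel inv_mult_group del: r_inv)
      ultimately show ?thesis using hk a b by simp
    qed
    have "h \<in> L" if "h \<in> H" for h
      using in_L[OF that one(2)] that Hc a by (auto simp: subset_iff)
    moreover have "x \<in> L" if x: "x \<in> conj_set G K (inv a)" for x
    proof -
      obtain k where k: "k \<in> K" "x = a \<otimes> k \<otimes> inv a" using x a by (auto simp: conj_set_def)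
      then have "k \<in> carrier G" using Kc by auto
      then show ?thesis using in_L[OF one(1) k(1)] k a by simp
    qed
    ultimately have "generate G ?P \<subseteq> L"
      using generate_subgroup_incl[OF _ L] by blast
    then show "generate G ?P #> (a \<otimes> b) \<subseteq> L #> c"
      unfolding Leq unfolding r_coset_def by (intro UN_mono) simp_all
  qed
qed

lemma (in group) K1_product_nontrivial:
  assumes "nontrivial_subgroup G H" "nontrivial_subgroup G K" "a \<in> carrier G"
  shows "nontrivial_subgroup G (generate G (H \<union> conj_set G K (inv a)))"
proof -
  have sg: "subgroup H G" "subgroup K G" using assms unfolding nontrivial_subgroup_def by auto
  have "H \<union> conj_set G K (inv a) \<subseteq> carrier G"
    using subgroup.subset[OF sg(1)] subgroup.subset[OF conj_set_subgroup[OF sg(2)]] assms(3) by auto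
  then have "subgroup (generate G (H \<union> conj_set G K (inv a))) G" by (rule generate_is_subgroup)
  moreover have "H \<subseteq> generate G (H \<union> conj_set G K (inv a))" by (auto intro: generate.incl)
  moreover have "\<one> \<in> H" "H \<noteq> {\<one>}"
    using assms(1) subgroup.one_closed unfolding nontrivial_subgroup_def by auto
  ultimately show ?thesis unfolding nontrivial_subgroup_def by blast
qed

lemma (in group) K1_mult_rcos:
  assumes "nontrivial_subgroup G H" "nontrivial_subgroup G K" "a \<in> carrier G" "b \<in> carrier G"
  shows "K1_mult G (H #> a) (K #> b) = generate G (H \<union> conj_set G K (inv a)) #> (a \<otimes> b)"
  unfolding K1_mult_def
proof (rule the_equality)
  show "\<exists>H' K' a' b'. nontrivial_subgroup G H' \<and> nontrivial_subgroup G K' \<and>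
        a' \<in> carrier G \<and> b' \<in> carrier G \<and> H #> a = H' #> a' \<and> K #> b = K' #> b' \<and>
        generate G (H \<union> conj_set G K (inv a)) #> (a \<otimes> b)
          = generate G (H' \<union> conj_set G K' (inv a')) #> (a' \<otimes> b')"
    using assms by blast
next
  fix C assume "\<exists>H' K' a' b'. nontrivial_subgroup G H' \<and> nontrivial_subgroup G K' \<and>
        a' \<in> carrier G \<and> b' \<in> carrier G \<and> H #> a = H' #> a' \<and> K #> b = K' #> b' \<and>
        C = generate G (H' \<union> conj_set G K' (inv a')) #> (a' \<otimes> b')"
  then obtain H' K' a' b' where *: "nontrivial_subgroup G H'" "nontrivial_subgroup G K'"
    "a' \<in> carrier G" "b' \<in> carrier G" "H #> a = H' #> a'" "K #> b = K' #> b'"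
    "C = generate G (H' \<union> conj_set G K' (inv a')) #> (a' \<otimes> b')" by blast
  let ?D = "generate G (H \<union> conj_set G K (inv a)) #> (a \<otimes> b)"
  have sg: "subgroup H G" "subgroup K G" "subgroup H' G" "subgroup K' G"
    using assms * unfolding nontrivial_subgroup_def by auto
  have sgP: "subgroup (generate G (H \<union> conj_set G K (inv a))) G"
    "subgroup (generate G (H' \<union> conj_set G K' (inv a'))) G"
    using K1_product_nontrivial assms * unfolding nontrivial_subgroup_def by auto
  have ab: "a \<otimes> b \<in> carrier G" "a' \<otimes> b' \<in> carrier G" using assms * by auto
  have "C \<subseteq> ?D"
    using K1_product_least[OF sg(3,4) *(3,4) sgP(1) ab(1)]
      K1_product_least[OF sg(1,2) assms(3,4) sgP(1) ab(1)] *(5-7) by simp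
  moreover have "?D \<subseteq> C"
    using K1_product_least[OF sg(1,2) assms(3,4) sgP(2) ab(2)]
      K1_product_least[OF sg(3,4) *(3,4) sgP(2) ab(2)] *(5-7) by simp
  ultimately show "C = ?D" by blast
qed

lemma (in group) K1_E:
  assumes "A \<in> K1 G"
  obtains H a where "nontrivial_subgroup G H" "subgroup H G" "a \<in> carrier G" "A = H #> a"
  using assms unfolding K1_def nontrivial_subgroup_def by blast

lemma (in group) K1_subset: "A \<in> K1 G \<Longrightarrow> A \<subseteq> carrier G"
  by (metis K1_E r_coset_subset_G subgroup.subset)

lemma (in group) K1_mult_closed:
  assumes "A \<in> K1 G" "B \<in> K1 G"
  shows "K1_mult G A B \<in> K1 G"
proof -
  obtain H a where A: "nontrivial_subgroup G H" "subgroup H G" "a \<in> carrier G" "A = H #> a"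
    using assms(1) K1_E by metis
  obtain K b where B: "nontrivial_subgroup G K" "subgroup K G" "b \<in> carrier G" "B = K #> b"
    using assms(2) K1_E by metis
  have "K1_mult G A B = generate G (H \<union> conj_set G K (inv a)) #> (a \<otimes> b)"
    unfolding A(4) B(4) by (rule K1_mult_rcos[OF A(1) B(1) A(3) B(3)])
  then show ?thesis
    using K1_product_nontrivial[OF A(1) B(1) A(3)] A(3) B(3) m_closed unfolding K1_def by blast
qed

lemma (in group) K1_mult_subset_iff:
  assumes "A \<in> K1 G" "B \<in> K1 G" "C \<in> K1 G"
  shows "K1_mult G A B \<subseteq> C \<longleftrightarrow> A <#> B \<subseteq> C"
proof -
  obtain H a where A: "nontrivial_subgroup G H" "subgroup H G" "a \<in> carrier G" "A = H #> a"
    using assms(1) K1_E by metis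
  obtain K b where B: "nontrivial_subgroup G K" "subgroup K G" "b \<in> carrier G" "B = K #> b"
    using assms(2) K1_E by metis
  obtain L c where C: "nontrivial_subgroup G L" "subgroup L G" "c \<in> carrier G" "C = L #> c"
    using assms(3) K1_E by metis
  show ?thesis
    unfolding A(4) B(4) C(4) K1_mult_rcos[OF A(1) B(1) A(3) B(3)]
    by (rule K1_product_least[OF A(2) B(2) A(3) B(3) C(2,3)])
qed

lemma (in group) conj_set_nontrivial:
  assumes "nontrivial_subgroup G H" "g \<in> carrier G"
  shows "nontrivial_subgroup G (conj_set G H g)"
proof -
  have H: "subgroup H G" "H \<noteq> {\<one>}" using assms unfolding nontrivial_subgroup_def by auto
  then obtain h where h: "h \<in> H" "h \<noteq> \<one>" using subgroup.one_closed by blast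
  have hc: "h \<in> carrier G" using h H subgroup.subset by blast
  have "inv g \<otimes> h \<otimes> g \<noteq> \<one>"
  proof
    assume "inv g \<otimes> h \<otimes> g = \<one>"
    then have "g \<otimes> (inv g \<otimes> h \<otimes> g) \<otimes> inv g = \<one>" using assms(2) by simp
    then show False using h hc assms(2) by (simp add: m_assoc cancel)
  qed
  moreover have "inv g \<otimes> h \<otimes> g \<in> conj_set G H g" using h by (auto simp: conj_set_def)
  ultimately show ?thesis
    using conj_set_subgroup[OF H(1) assms(2)] unfolding nontrivial_subgroup_def by blast
qed

lemma (in group) lcos_rcos:
  assumes "subgroup H G" "g \<in> carrier G" "a \<in> carrier G"
  shows "inv g <# (H #> a) = conj_set G H g #> (inv g \<otimes> a)"
proof -
  have "inv g \<otimes> (h \<otimes> a) = (inv g \<otimes> h \<otimes> g) \<otimes> (inv g \<otimes> a)" if "h \<in> H" for h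
    using that subgroup.subset[OF assms(1)] assms(2,3) by (auto simp: m_assoc cancel)
  then show ?thesis
    unfolding l_coset_def r_coset_def conj_set_def by auto
qed

lemma (in group) K1_translate:
  assumes "C \<in> K1 G" "g \<in> carrier G"
  shows "C #> g \<in> K1 G" and "g <# C \<in> K1 G"
proof -
  obtain L c where C: "nontrivial_subgroup G L" "subgroup L G" "c \<in> carrier G" "C = L #> c"
    using assms(1) K1_E by metis
  have "C #> g = L #> (c \<otimes> g)"
    unfolding C(4) using coset_mult_assoc[OF subgroup.subset[OF C(2)] C(3) assms(2)] .
  then show "C #> g \<in> K1 G" using C assms(2) unfolding K1_def by blast
  have "g <# C = conj_set G L (inv g) #> (g \<otimes> c)"
    unfolding C(4) using lcos_rcos[OF C(2) inv_closed[OF assms(2)] C(3)] assms(2) by simp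
  then show "g <# C \<in> K1 G"
    using conj_set_nontrivial[OF C(1) inv_closed[OF assms(2)]] C(3) assms(2) unfolding K1_def by blast
qed

lemma (in group) set_mult_subset_iff:
  assumes "A \<subseteq> carrier G" "B \<subseteq> carrier G" "D \<subseteq> carrier G"
  shows "A <#> B \<subseteq> D \<longleftrightarrow> (\<forall>b\<in>B. A \<subseteq> D #> inv b)"
    and "A <#> B \<subseteq> D \<longleftrightarrow> (\<forall>a\<in>A. B \<subseteq> inv a <# D)"
proof -
  have r: "x \<in> D #> inv b \<longleftrightarrow> x \<otimes> b \<in> D" if "x \<in> carrier G" "b \<in> carrier G" for x b
    using mem_rcos[OF assms(3), of "inv b" x] that by simp
  have l: "x \<in> inv a <# D \<longleftrightarrow> a \<otimes> x \<in> D" if "x \<in> carrier G" "a \<in> carrier G" for x a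
  proof
    assume "x \<in> inv a <# D"
    then obtain d where "d \<in> D" "x = inv a \<otimes> d" unfolding l_coset_def by blast
    then show "a \<otimes> x \<in> D" using that assms(3) by (auto simp: cancel)
  next
    assume "a \<otimes> x \<in> D"
    moreover have "x = inv a \<otimes> (a \<otimes> x)" using that by (simp add: cancel)
    ultimately show "x \<in> inv a <# D" unfolding l_coset_def by blast
  qed
  have m: "A <#> B \<subseteq> D \<longleftrightarrow> (\<forall>a\<in>A. \<forall>b\<in>B. a \<otimes> b \<in> D)" unfolding set_mult_def by blast
  show "A <#> B \<subseteq> D \<longleftrightarrow> (\<forall>b\<in>B. A \<subseteq> D #> inv b)"
    unfolding m using r assms(1,2) by (meson subset_iff)
  show "A <#> B \<subseteq> D \<longleftrightarrow> (\<forall>a\<in>A. B \<subseteq> inv a <# D)"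
    unfolding m using l assms(1,2) by (meson subset_iff)
qed

lemma (in group) K1_mult_assoc:
  assumes "A \<in> K1 G" "B \<in> K1 G" "C \<in> K1 G"
  shows "K1_mult G (K1_mult G A B) C = K1_mult G A (K1_mult G B C)"
proof -
  have AB: "K1_mult G A B \<in> K1 G" and BC: "K1_mult G B C \<in> K1 G"
    using assms K1_mult_closed by auto
  have l: "K1_mult G (K1_mult G A B) C \<in> K1 G" and r: "K1_mult G A (K1_mult G B C) \<in> K1 G"
    using assms AB BC K1_mult_closed by auto
  note sub = K1_subset[OF assms(1)] K1_subset[OF assms(2)] K1_subset[OF assms(3)]
  have ABs: "A <#> B \<subseteq> carrier G" and BCs: "B <#> C \<subseteq> carrier G"
    using sub set_mult_closed by auto
  have "K1_mult G (K1_mult G A B) C \<subseteq> D \<longleftrightarrow> K1_mult G A (K1_mult G B C) \<subseteq> D" if D: "D \<in> K1 G" for D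
  proof -
    note Ds = K1_subset[OF D]
    have "K1_mult G (K1_mult G A B) C \<subseteq> D \<longleftrightarrow> (\<forall>c\<in>C. K1_mult G A B \<subseteq> D #> inv c)"
      using K1_mult_subset_iff[OF AB assms(3) D] set_mult_subset_iff(1)[OF K1_subset[OF AB] sub(3) Ds]
      by simp
    also have "\<dots> \<longleftrightarrow> (\<forall>c\<in>C. A <#> B \<subseteq> D #> inv c)"
      using K1_mult_subset_iff[OF assms(1,2)] K1_translate(1)[OF D] sub(3) by (meson inv_closed subset_iff)
    also have "\<dots> \<longleftrightarrow> (A <#> B) <#> C \<subseteq> D"
      using set_mult_subset_iff(1)[OF ABs sub(3) Ds] by simp
    also have "\<dots> \<longleftrightarrow> A <#> (B <#> C) \<subseteq> D"
      using set_mult_assoc[OF sub] by simp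
    also have "\<dots> \<longleftrightarrow> (\<forall>a\<in>A. B <#> C \<subseteq> inv a <# D)"
      using set_mult_subset_iff(2)[OF sub(1) BCs Ds] by simp
    also have "\<dots> \<longleftrightarrow> (\<forall>a\<in>A. K1_mult G B C \<subseteq> inv a <# D)"
      using K1_mult_subset_iff[OF assms(2,3)] K1_translate(2)[OF D] sub(1) by (meson inv_closed subset_iff)
    also have "\<dots> \<longleftrightarrow> K1_mult G A (K1_mult G B C) \<subseteq> D"
      using K1_mult_subset_iff[OF assms(1) BC D] set_mult_subset_iff(2)[OF sub(1) K1_subset[OF BC] Ds]
      by simp
    finally show ?thesis .
  qed
  from this[OF l] this[OF r] show ?thesis by blast
qed

text \<open>The inverse of \<open>Ha\<close> is the coset \<open>{x\<^sup>-\<^sup>1 | x \<in> Ha} = H\<^sup>a a\<^sup>-\<^sup>1\<close>.\<close>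

lemma (in group) K1_mult_self_inv:
  assumes H: "nontrivial_subgroup G H" and a: "a \<in> carrier G"
  defines "y \<equiv> conj_set G H a #> inv a"
  shows "y \<in> K1 G" "K1_mult G (H #> a) y = H" "K1_mult G y (H #> a) = conj_set G H a"
    "K1_mult G (K1_mult G (H #> a) y) (H #> a) = H #> a"
    "K1_mult G (K1_mult G y (H #> a)) y = y"
proof -
  have sH: "subgroup H G" using H unfolding nontrivial_subgroup_def by simp
  note Hc = subgroup.subset[OF sH]
  have C: "nontrivial_subgroup G (conj_set G H a)" by (rule conj_set_nontrivial[OF H a])
  have sC: "subgroup (conj_set G H a) G" by (rule conj_set_subgroup[OF sH a])
  note Cc = subgroup.subset[OF sC]
  have cc: "conj_set G (conj_set G H a) (inv a) = H"
  proof -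
    have "inv (inv a) \<otimes> (inv a \<otimes> h \<otimes> a) \<otimes> inv a = h" if "h \<in> H" for h
      using that Hc a by (auto simp: m_assoc cancel)
    then show ?thesis unfolding conj_set_def image_image by simp
  qed
  have conj_one: "conj_set G K \<one> = K" if "K \<subseteq> carrier G" for K
  proof -
    have "inv \<one> \<otimes> k \<otimes> \<one> = k" if "k \<in> K" for k using that \<open>K \<subseteq> carrier G\<close> by auto
    then show ?thesis unfolding conj_set_def by simp
  qed
  have gen: "generate G K = K" if "subgroup K G" for K
    using that generateI[OF that subset_refl] by blast
  show "y \<in> K1 G" using C a unfolding y_def K1_def by blast
  show 1: "K1_mult G (H #> a) y = H"
    unfolding y_def K1_mult_rcos[OF H C a inv_closed[OF a]] cc
    using gen[OF sH] a Hc by (simp add: coset_mult_one)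
  show 2: "K1_mult G y (H #> a) = conj_set G H a"
    unfolding y_def K1_mult_rcos[OF C H inv_closed[OF a] a]
    using gen[OF sC] a Cc by (simp add: coset_mult_one)
  show "K1_mult G (K1_mult G (H #> a) y) (H #> a) = H #> a"
    unfolding 1 using K1_mult_rcos[OF H H one_closed a] gen[OF sH] a Hc
    by (simp add: coset_mult_one conj_one del: inv_one) (simp add: conj_one)
  show "K1_mult G (K1_mult G y (H #> a)) y = y"
    unfolding 2 unfolding y_def using K1_mult_rcos[OF C C one_closed inv_closed[OF a]] gen[OF sC] a Cc
    by (simp add: coset_mult_one conj_one)
qed

lemma (in group) K1_inv_unique:
  assumes H: "nontrivial_subgroup G H" and a: "a \<in> carrier G" and y: "y \<in> K1 G"
    and xyx: "K1_mult G (K1_mult G (H #> a) y) (H #> a) = H #> a"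
    and yxy: "K1_mult G (K1_mult G y (H #> a)) y = y"
  shows "y = conj_set G H a #> inv a"
proof -
  have sH: "subgroup H G" using H unfolding nontrivial_subgroup_def by simp
  note Hc = subgroup.subset[OF sH]
  obtain K b where K: "nontrivial_subgroup G K" "subgroup K G" "b \<in> carrier G" "y = K #> b"
    using y K1_E by metis
  note Kc = subgroup.subset[OF K(2)]
  have x: "H #> a \<in> K1 G" using H a unfolding K1_def by blast
  have xs: "H #> a \<subseteq> carrier G" and ys: "y \<subseteq> carrier G" using x y K1_subset by auto
  have closed: "K1_mult G (H #> a) y \<in> K1 G" "K1_mult G y (H #> a) \<in> K1 G"
    using x y K1_mult_closed by auto
  have incl: "A <#> B \<subseteq> K1_mult G A B" if "A \<in> K1 G" "B \<in> K1 G" for A B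
    using K1_mult_subset_iff[OF that K1_mult_closed[OF that]] by simp
  have tri: "u \<otimes> v \<otimes> w \<in> K1_mult G (K1_mult G A B) A"
    if "A \<in> K1 G" "B \<in> K1 G" "u \<in> A" "v \<in> B" "w \<in> A" for A B u v w
  proof -
    have "u \<otimes> v \<in> K1_mult G A B" using incl[OF that(1,2)] that unfolding set_mult_def by blast
    then show ?thesis
      using incl[OF K1_mult_closed[OF that(1,2)] that(1)] that unfolding set_mult_def by blast
  qed
  have p1: "u \<otimes> v \<otimes> w \<in> H #> a" if "u \<in> H #> a" "v \<in> y" "w \<in> H #> a" for u v w
    using tri[OF x y that] xyx by simp
  have p2: "u \<otimes> v \<otimes> w \<in> y" if "u \<in> y" "v \<in> H #> a" "w \<in> y" for u v w
    using tri[OF y x that] yxy by simp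
  have aH: "a \<in> H #> a" using rcos_self[OF a sH] .
  have bK: "b \<in> y" using rcos_self[OF K(3,2)] K(4) by simp
  have c1: "a \<otimes> v \<in> H" if "v \<in> y" for v
  proof -
    have "a \<otimes> v \<otimes> a \<otimes> inv a \<in> H" using p1[OF aH that aH] mem_rcos[OF Hc a] by simp
    then show ?thesis using that ys a by (auto simp: m_assoc)
  qed
  have sub: "y \<subseteq> conj_set G H a #> inv a"
  proof
    fix v assume v: "v \<in> y"
    then have vc: "v \<in> carrier G" using ys by auto
    have "v = (inv a \<otimes> (a \<otimes> v) \<otimes> a) \<otimes> inv a" using vc a by (simp add: m_assoc cancel)
    then show "v \<in> conj_set G H a #> inv a"
      using c1[OF v] unfolding r_coset_def conj_set_def by blast
  qed
  have "conj_set G H a #> inv a \<subseteq> y"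
  proof
    fix v assume "v \<in> conj_set G H a #> inv a"
    then obtain h where h: "h \<in> H" "v = inv a \<otimes> h \<otimes> a \<otimes> inv a"
      unfolding r_coset_def conj_set_def by blast
    have hc: "h \<in> carrier G" using h Hc by auto
    have v: "v = inv a \<otimes> h" using h hc a by (simp add: m_assoc)
    let ?g = "a \<otimes> b"
    have g: "?g \<in> H" using c1[OF bK] .
    have gc: "?g \<in> carrier G" using a K(3) by simp
    have w: "inv ?g \<otimes> h \<otimes> inv ?g \<otimes> a \<in> H #> a"
      using h(1) g sH a unfolding r_coset_def
      by (auto intro!: subgroup.m_closed[OF sH] subgroup.m_inv_closed[OF sH])
    have "b \<otimes> (inv ?g \<otimes> h \<otimes> inv ?g \<otimes> a) \<otimes> b \<in> y" by (rule p2[OF bK w bK])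
    moreover have "b \<otimes> (inv ?g \<otimes> h \<otimes> inv ?g \<otimes> a) \<otimes> b = v"
      using hc a K(3) v by (simp add: inv_mult_group m_assoc cancel)
    ultimately show "v \<in> y" by simp
  qed
  with sub show ?thesis by blast
qed

lemma (in group) K1_inverse_semigroup: "inverse_semigroup (K1 G) (K1_mult G)"
  unfolding inverse_semigroup_def
proof (intro conjI ballI)
  fix x assume "x \<in> K1 G"
  then obtain H a where x: "nontrivial_subgroup G H" "a \<in> carrier G" "x = H #> a"
    using K1_E by metis
  show "\<exists>!y. y \<in> K1 G \<and> K1_mult G (K1_mult G x y) x = x \<and> K1_mult G (K1_mult G y x) y = y"
    unfolding x(3)
    by (rule ex1I[of _ "conj_set G H a #> inv a"])
      (use K1_mult_self_inv(1,4,5)[OF x(1,2)] K1_inv_unique[OF x(1,2)] in blast)+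
qed (blast intro: K1_mult_closed, rule K1_mult_assoc)

lemma (in group) K1_semigroup_inv:
  assumes "nontrivial_subgroup G H" "a \<in> carrier G"
  shows "semigroup_inv (K1 G) (K1_mult G) (H #> a) = conj_set G H a #> inv a"
  unfolding semigroup_inv_def
  by (rule the_equality)
    (use K1_mult_self_inv(1,4,5)[OF assms] K1_inv_unique[OF assms] in blast)+

lemma (in group) K1_idempotents:
  "idempotents (K1 G) (K1_mult G) = {H. nontrivial_subgroup G H}"
proof (rule Set.set_eqI, rule iffI)
  fix A assume "A \<in> idempotents (K1 G) (K1_mult G)"
  then have A: "A \<in> K1 G" "K1_mult G A A = A" unfolding idempotents_def by auto
  then obtain H a where H: "nontrivial_subgroup G H" "subgroup H G" "a \<in> carrier G" "A = H #> a"
    using K1_E by metis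
  have "A <#> A \<subseteq> A" using K1_mult_subset_iff[OF A(1) A(1) A(1)] A(2) by simp
  moreover have aA: "a \<in> A" using rcos_self[OF H(3,2)] H(4) by simp
  ultimately have "a \<otimes> a \<in> H #> a" unfolding set_mult_def H(4) by blast
  then have "a \<otimes> a \<otimes> inv a \<in> H" using mem_rcos[OF subgroup.subset[OF H(2)] H(3)] by simp
  then have "a \<in> H" using H(3) by (simp add: m_assoc)
  then have "A = H" using coset_join2[OF H(3,2)] H(4) by simp
  then show "A \<in> {H. nontrivial_subgroup G H}" using H(1) by simp
next
  fix H assume "H \<in> {H. nontrivial_subgroup G H}"
  then have H: "nontrivial_subgroup G H" "subgroup H G" unfolding nontrivial_subgroup_def by auto
  have H1: "H #> \<one> = H" using subgroup.subset[OF H(2)] by (rule coset_mult_one)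
  have "H \<in> K1 G" using H(1) H1 one_closed unfolding K1_def by blast
  moreover have "conj_set G H \<one> = H"
  proof -
    have "inv \<one> \<otimes> k \<otimes> \<one> = k" if "k \<in> H" for k using that subgroup.subset[OF H(2)] by auto
    then show ?thesis unfolding conj_set_def by simp
  qed
  then have "K1_mult G H H = H" using K1_mult_self_inv(2)[OF H(1) one_closed] H1 by simp
  ultimately show "H \<in> idempotents (K1 G) (K1_mult G)" unfolding idempotents_def by simp
qed

lemma (in group) K1_natural_le:
  assumes "A \<in> K1 G" "B \<in> K1 G"
  shows "natural_le (K1 G) (K1_mult G) A B \<longleftrightarrow> B \<subseteq> A"
proof
  assume "natural_le (K1 G) (K1_mult G) A B"
  then obtain L where L: "nontrivial_subgroup G L" "A = K1_mult G L B"
    unfolding natural_le_def K1_idempotents by blast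
  have L1: "L #> \<one> = L" "\<one> \<in> L"
    using L(1) by (auto simp: nontrivial_subgroup_def coset_mult_one subgroup.subset subgroup.one_closed)
  have LK: "L \<in> K1 G" using L(1) L1 one_closed unfolding K1_def by blast
  have "L <#> B \<subseteq> A" using K1_mult_subset_iff[OF LK assms(2,1)] L(2) by simp
  moreover have "b \<in> L <#> B" if "b \<in> B" for b
  proof -
    have "b \<in> carrier G" using that K1_subset[OF assms(2)] by blast
    then have "\<one> \<otimes> b = b" by simp
    moreover have "\<one> \<otimes> b \<in> L <#> B" using that L1(2) unfolding set_mult_def by blast
    ultimately show ?thesis by simp
  qed
  ultimately show "B \<subseteq> A" by blast
next
  assume BA: "B \<subseteq> A"
  obtain H a where A: "nontrivial_subgroup G H" "subgroup H G" "a \<in> carrier G" "A = H #> a"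
    using assms(1) K1_E by metis
  have H1: "H #> \<one> = H" "\<one> \<in> H"
    using A(2) by (auto simp: coset_mult_one subgroup.subset subgroup.one_closed)
  have HK: "H \<in> K1 G" using A(1) H1 one_closed unfolding K1_def by blast
  obtain b where b: "b \<in> B"
  proof -
    obtain K c where "subgroup K G" "c \<in> carrier G" "B = K #> c" using assms(2) K1_E by metis
    then have "c \<in> B" using rcos_self by simp
    then show thesis by (rule that)
  qed
  then have bc: "b \<in> carrier G" and bA: "b \<in> A" using K1_subset[OF assms(2)] BA by auto
  have Ab: "A = H #> b" using repr_independence[OF _ A(3,2)] bA A(4) by simp
  have "K1_mult G H B = A"
  proof
    have Hc: "H \<subseteq> carrier G" by (rule subgroup.subset[OF A(2)])
    have "H <#> A = A"
      using setmult_rcos_assoc[OF Hc Hc A(3)] subgroup_mult_id[OF A(2)] A(4) by simp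
    then have "H <#> B \<subseteq> A" using mono_set_mult[OF subset_refl BA] by blast
    then show "K1_mult G H B \<subseteq> A" using K1_mult_subset_iff[OF HK assms(2,1)] by simp
    have "H <#> B \<subseteq> K1_mult G H B"
      using K1_mult_subset_iff[OF HK assms(2) K1_mult_closed[OF HK assms(2)]] by simp
    moreover have "A \<subseteq> H <#> B"
      using b unfolding Ab set_mult_def r_coset_def by blast
    ultimately show "A \<subseteq> K1_mult G H B" by blast
  qed
  then show "natural_le (K1 G) (K1_mult G) A B"
    unfolding natural_le_def K1_idempotents using A(1) by blast
qed

end

theory Submission
  imports Defs "HOL-Algebra.Multiplicative_Group"
begin

text \<open>\<open>eta\<close> is always a homomorphism into the units. If
  \<open>eta a = eta b\<close>, then ab^-1 lies in every minimal subgroup, and two distinct ones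
  meet trivially, so a = b. The question is therefore surjectivity. A unit contains a coset of each
  non-trivial subgroup, and these are linked: if it contains Ha and Kb, then ba^-1 lies in every
  subgroup above H and K (\<open>compatible_rcosD\<close>). It also contains every larger coset, so
  by periodicity its cosets of minimal subgroups determine it.

  Let a unit contain Hr r. For each minimal H it contains H a_H r with a_H in Hr. If H and K are
  adjacent, a_H a_K^-1 lies in HK and in Hr, so it is 1. On a connected graph a_H is thus a constant
  a, and the unit is \<open>eta\<close> of ar (\<open>unit_in_range_eta\<close>).

  If the graph is disconnected, fix d \<noteq> 1 in Hr and a component. Give representative d to the
  subgroups that lie over the component but not over Hr, and 1 to all others. The minimal subgroups
  inside a subgroup not containing Hr are pairwise adjacent, so the representative changes only on
  passing to a subgroup that contains Hr and absorbs d. Since Hr normalizes all minimal subgroups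
  (\<open>minimal_subgroup_normalizes\<close>), the choice also respects the conjugation in the
  product. So this is a unit (\<open>family_unit\<close>). Were it \<open>eta b\<close>, then b
  would lie in Hr and in a minimal subgroup of another component, so b = 1; then d would lie in a
  minimal subgroup of the chosen component, which is impossible
  (\<open>connected_if_eta_surj\<close>).\<close>

section \<open>Minimal subgroups\<close>

lemma nontrivial_subgroupD:
  assumes "nontrivial_subgroup G H"
  shows "subgroup H G" "H \<subseteq> carrier G" "\<one>\<^bsub>G\<^esub> \<in> H"
  using assms subgroup.subset subgroup.one_closed
  unfolding nontrivial_subgroup_def by blast+

lemma minimal_subgroupsD:
  assumes "H \<in> minimal_subgroups G"
  shows "nontrivial_subgroup G H" "\<And>K. nontrivial_subgroup G K \<Longrightarrow> K \<subseteq> H \<Longrightarrow> K = H"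
  using assms unfolding minimal_subgroups_def by blast+

context group
begin

lemma conj_set_one: "K \<subseteq> carrier G \<Longrightarrow> conj_set G K \<one> = K"
  using mem_conj_set[of K \<one>] by auto

lemma conj_set_conj_set:
  assumes "K \<subseteq> carrier G" "a \<in> carrier G" "b \<in> carrier G"
  shows "conj_set G (conj_set G K a) b = conj_set G K (a \<otimes> b)"
proof -
  have "inv b \<otimes> (inv a \<otimes> k \<otimes> a) \<otimes> b = inv (a \<otimes> b) \<otimes> k \<otimes> (a \<otimes> b)" if "k \<in> K" for k
    using that assms by (auto simp: m_assoc inv_mult_group subset_iff)
  then show ?thesis unfolding conj_set_def image_image by simp
qed

lemma conj_set_mono: "K \<subseteq> L \<Longrightarrow> conj_set G K a \<subseteq> conj_set G L a"
  unfolding conj_set_def by blast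

lemma conj_set_self:
  assumes "subgroup K G" "a \<in> K"
  shows "conj_set G K a = K"
proof -
  have c: "a \<in> carrier G" "K \<subseteq> carrier G" using assms subgroup.subset by blast+
  have sub: "conj_set G K b \<subseteq> K" if "b \<in> K" for b
    using that assms(1) unfolding conj_set_def
    by (auto intro!: subgroup.m_closed subgroup.m_inv_closed)
  have "K = conj_set G (conj_set G K (inv a)) a"
    using c by (simp add: conj_set_conj_set conj_set_one)
  also have "\<dots> \<subseteq> conj_set G K a"
    using assms by (intro conj_set_mono sub subgroup.m_inv_closed)
  finally show ?thesis using sub[OF assms(2)] by blast
qed

text \<open>The intersection of H and K is non-trivial because of x, so minimality makes it all of
  H. This is how a single element forces a containment below.\<close>

lemma minimal_subgroup_le:
  assumes "H \<in> minimal_subgroups G" "subgroup K G" "x \<in> H" "x \<in> K" "x \<noteq> \<one>"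
  shows "H \<subseteq> K"
proof -
  have "subgroup (H \<inter> K) G"
    using minimal_subgroupsD(1)[OF assms(1)] assms(2)
    by (intro subgroups_Inter_pair) (auto simp: nontrivial_subgroup_def)
  then have "nontrivial_subgroup G (H \<inter> K)"
    using assms(3-5) unfolding nontrivial_subgroup_def by blast
  then show ?thesis using minimal_subgroupsD(2)[OF assms(1)] by blast
qed

lemma minimal_subgroups_disjoint:
  assumes "H \<in> minimal_subgroups G" "K \<in> minimal_subgroups G" "H \<noteq> K"
  shows "H \<inter> K = {\<one>}"
proof -
  note nt = assms(1,2)[THEN minimal_subgroupsD(1)]
  have "x = \<one>" if "x \<in> H" "x \<in> K" for x
    using minimal_subgroup_le[OF assms(1) nontrivial_subgroupD(1)[OF nt(2)] that]
      minimal_subgroupsD(2)[OF assms(2) nt(1)] assms(3) by blast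
  then show ?thesis using nt[THEN nontrivial_subgroupD(3)] by blast
qed

lemma conj_set_minimal:
  assumes "H \<in> minimal_subgroups G" "a \<in> carrier G"
  shows "conj_set G H a \<in> minimal_subgroups G"
proof -
  note H = minimal_subgroupsD[OF assms(1)]
  note Hc = nontrivial_subgroupD(2)[OF H(1)]
  have "K = conj_set G H a" if K: "nontrivial_subgroup G K" "K \<subseteq> conj_set G H a" for K
  proof -
    have "conj_set G K (inv a) \<subseteq> conj_set G (conj_set G H a) (inv a)"
      using K(2) by (rule conj_set_mono)
    then have "conj_set G K (inv a) \<subseteq> H"
      using Hc assms(2) by (simp add: conj_set_conj_set conj_set_one)
    then have "conj_set G K (inv a) = H"
      using H(2) conj_set_nontrivial[OF K(1)] assms(2) by simp
    then have "conj_set G H a = conj_set G (conj_set G K (inv a)) a" by simp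
    then show ?thesis
      using nontrivial_subgroupD(2)[OF K(1)] assms(2) by (simp add: conj_set_conj_set conj_set_one)
  qed
  then show ?thesis
    using conj_set_nontrivial[OF H(1) assms(2)] unfolding minimal_subgroups_def by blast
qed

lemma set_mult_subgroup:
  assumes H: "subgroup H G" and K: "subgroup K G" and "H <#> K = K <#> H"
  shows "subgroup (H <#> K) G"
proof (rule subgroupI)
  have c: "H \<subseteq> carrier G" "K \<subseteq> carrier G" using H K subgroup.subset by auto
  show "H <#> K \<subseteq> carrier G" by (rule set_mult_closed[OF c])
  show "H <#> K \<noteq> {}"
    using subgroup.one_closed[OF H] subgroup.one_closed[OF K] unfolding set_mult_def by blast
  fix x assume x: "x \<in> H <#> K"
  then obtain h k where hk: "h \<in> H" "k \<in> K" "x = h \<otimes> k" unfolding set_mult_def by blast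
  then have "inv x = inv k \<otimes> inv h" using c by (auto intro: inv_mult_group)
  moreover have "inv k \<otimes> inv h \<in> K <#> H"
    using subgroup.m_inv_closed[OF H hk(1)] subgroup.m_inv_closed[OF K hk(2)]
    unfolding set_mult_def by blast
  ultimately show "inv x \<in> H <#> K" by (metis assms(3))
  fix y assume y: "y \<in> H <#> K"
  have "x \<otimes> y \<in> (H <#> K) <#> (H <#> K)" using x y unfolding set_mult_def by blast
  also have "(H <#> K) <#> (H <#> K) = H <#> (K <#> H) <#> K"
    using c by (simp add: set_mult_assoc set_mult_closed)
  also have "\<dots> = (H <#> H) <#> (K <#> K)"
    unfolding assms(3)[symmetric] using c by (simp add: set_mult_assoc set_mult_closed)
  also have "\<dots> = H <#> K" using subgroup_mult_id[OF H] subgroup_mult_id[OF K] by simp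
  finally show "x \<otimes> y \<in> H <#> K" .
qed

lemma subset_set_mult:
  assumes "subgroup H G" "subgroup K G"
  shows "H \<subseteq> H <#> K" "K \<subseteq> H <#> K"
proof -
  have "h \<otimes> \<one> \<in> H <#> K" if "h \<in> H" for h
    using that subgroup.one_closed[OF assms(2)] unfolding set_mult_def by blast
  then show "H \<subseteq> H <#> K" using subgroup.mem_carrier[OF assms(1)] by (metis r_one subsetI)
  have "\<one> \<otimes> k \<in> H <#> K" if "k \<in> K" for k
    using that subgroup.one_closed[OF assms(1)] unfolding set_mult_def by blast
  then show "K \<subseteq> H <#> K" using subgroup.mem_carrier[OF assms(2)] by (metis l_one subsetI)
qed

text \<open>
  If \<open>L = K\<^sup>a\<close> differed from \<open>K\<close>, then \<open>KL\<close> would contain \<open>H\<close>, so \<open>a = kl\<close>, and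
  \<open>L = K\<^sup>k\<^sup>l = K\<^sup>l\<close> with \<open>l \<in> L\<close> would give \<open>K = L\<close>.
\<close>

lemma minimal_subgroup_normalizes:
  assumes perm: "\<forall>H\<in>minimal_subgroups G. \<forall>K\<in>minimal_subgroups G. H <#> K = K <#> H"
    and H: "H \<in> minimal_subgroups G" and K: "K \<in> minimal_subgroups G" and a: "a \<in> H"
  shows "conj_set G K a = K"
proof (rule ccontr)
  let ?L = "conj_set G K a"
  assume ne: "?L \<noteq> K"
  have sH: "subgroup H G" and sK: "subgroup K G"
    using H K minimal_subgroupsD(1) nontrivial_subgroupD(1) by blast+
  note Hc = subgroup.subset[OF sH] and Kc = subgroup.subset[OF sK]
  have ac: "a \<in> carrier G" using a Hc by blast
  have L: "?L \<in> minimal_subgroups G" by (rule conj_set_minimal[OF K ac])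
  have sL: "subgroup ?L G" by (rule conj_set_subgroup[OF sK ac])
  note Lc = subgroup.subset[OF sL]
  have sKL: "subgroup (K <#> ?L) G" using set_mult_subgroup[OF sK sL] perm K L by blast
  have sKH: "subgroup (K <#> H) G" using set_mult_subgroup[OF sK sH] perm K H by blast
  have "?L \<subseteq> K <#> H"
  proof
    fix x assume "x \<in> ?L"
    then obtain k where k: "k \<in> K" "x = inv a \<otimes> k \<otimes> a" unfolding conj_set_def by blast
    have "a \<in> K <#> H" "k \<in> K <#> H" using a k subset_set_mult[OF sK sH] by auto
    then show "x \<in> K <#> H"
      unfolding k(2) using sKH by (intro subgroup.m_closed[OF sKH] subgroup.m_inv_closed[OF sKH])
  qed
  \<comment> \<open>Writing l = kh, the factor h = k^-1 l is a non-trivial element of H in the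
    subgroup KL. By minimality all of H, in particular a, lies in KL.\<close>
  moreover obtain l where l: "l \<in> ?L" "l \<notin> K"
    using ne minimal_subgroupsD(2)[OF K minimal_subgroupsD(1)[OF L]] by blast
  ultimately obtain k h where kh: "k \<in> K" "h \<in> H" "l = k \<otimes> h" unfolding set_mult_def by blast
  have c: "k \<in> carrier G" "h \<in> carrier G" using kh Kc Hc by auto
  have "h \<noteq> \<one>" using l(2) kh c by auto
  moreover have "inv k \<otimes> l \<in> K <#> ?L"
    using subgroup.m_inv_closed[OF sK kh(1)] l(1) unfolding set_mult_def by blast
  then have "h \<in> K <#> ?L" using c kh(3) by (simp add: cancel)
  ultimately have "H \<subseteq> K <#> ?L" using minimal_subgroup_le[OF H sKL kh(2)] by blast
  then obtain k' l' where k'l': "k' \<in> K" "l' \<in> ?L" "a = k' \<otimes> l'"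
    using a unfolding set_mult_def by blast
  have c': "k' \<in> carrier G" "l' \<in> carrier G" using k'l' Kc Lc by auto
  have "?L = conj_set G (conj_set G K k') l'"
    using k'l'(3) c' Kc by (simp add: conj_set_conj_set)
  then have "?L = conj_set G K l'" using conj_set_self[OF sK k'l'(1)] by simp
  moreover have "?L = conj_set G ?L l'" using conj_set_self[OF sL k'l'(2)] by simp
  ultimately have "conj_set G (conj_set G K l') (inv l') = conj_set G (conj_set G ?L l') (inv l')"
    by simp
  then have "K = ?L" using c' Kc Lc by (simp add: conj_set_conj_set[OF _ c'(2) inv_closed[OF c'(2)]] conj_set_one)
  with ne show False by simp
qed

text \<open>A non-trivial element generates a finite subgroup, so K has finite non-trivial
  subgroups; one of least order is minimal.\<close>

lemma periodic_minimal_subgroup_exists: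
  assumes "periodic_group G" "nontrivial_subgroup G K"
  obtains H where "H \<in> minimal_subgroups G" "H \<subseteq> K"
proof -
  note K = nontrivial_subgroupD[OF assms(2)]
  obtain x where x: "x \<in> K" "x \<noteq> \<one>"
    using assms(2) K(3) unfolding nontrivial_subgroup_def by blast
  then have xc: "x \<in> carrier G" using K(2) by blast
  let ?Q = "\<lambda>L. nontrivial_subgroup G L \<and> finite L \<and> L \<subseteq> K"
  have "ord x \<noteq> 0"
    using assms(1) xc unfolding periodic_group_def ord_eq_0[OF xc] by blast
  then have "finite (generate G {x})" using generate_pow_card[OF xc] card_ge_0_finite by force
  moreover have "generate G {x} \<subseteq> K" using generate_subgroup_incl[OF _ K(1)] x(1) by blast
  moreover have "subgroup (generate G {x}) G" using xc by (intro generate_is_subgroup) simp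
  moreover have "x \<in> generate G {x}" by (simp add: generate.incl)
  ultimately have "?Q (generate G {x})" using x(2) unfolding nontrivial_subgroup_def by blast
  then obtain H where H: "?Q H" and least: "\<And>L. ?Q L \<Longrightarrow> card H \<le> card L"
    using ex_has_least_nat[of ?Q "generate G {x}" card] by metis
  have "L = H" if "nontrivial_subgroup G L" "L \<subseteq> H" for L
  proof (rule card_seteq)
    have "finite L" "L \<subseteq> K" using that(2) H finite_subset by auto
    then show "card H \<le> card L" using least that(1) by blast
  qed (use H that(2) in auto)
  then have "H \<in> minimal_subgroups G" using H unfolding minimal_subgroups_def by blast
  then show thesis using that H by blast
qed

end

section \<open>Permissible sets and units given by coset representatives\<close>

text \<open>
  A family of cosets with representatives in \<open>{\<one>, d}\<close>, where the predicate \<open>P\<close> selects the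
  subgroups that get \<open>d\<close>. With \<open>D = G\<close> and \<open>P\<close> constantly true this is \<open>\<eta>\<close>; other choices
  of \<open>P\<close> yield the units outside the image of \<open>\<eta>\<close>.
\<close>

locale coset_family = group G for G (structure) +
  fixes D :: "'a set" and P :: "'a set \<Rightarrow> bool"
  assumes subgroup_D: "subgroup D G"
    and P_conj: "nontrivial_subgroup G H \<Longrightarrow> d \<in> D \<Longrightarrow> P (conj_set G H d) \<longleftrightarrow> P H"
    and P_mono: "nontrivial_subgroup G H \<Longrightarrow> nontrivial_subgroup G K \<Longrightarrow> H \<subseteq> K \<Longrightarrow>
      D \<subseteq> K \<or> (P H \<longleftrightarrow> P K)"
begin

definition rep :: "'a \<Rightarrow> 'a set \<Rightarrow> 'a" where
  "rep d H = (if P H then d else \<one>)"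

definition family :: "'a \<Rightarrow> 'a set set" where
  "family d = {H #> rep d H | H. nontrivial_subgroup G H}"

lemma rep_D: "d \<in> D \<Longrightarrow> rep d H \<in> D"
  using subgroup.one_closed[OF subgroup_D] by (simp add: rep_def)

lemma D_carrier: "d \<in> D \<Longrightarrow> d \<in> carrier G"
  using subgroup.subset[OF subgroup_D] by blast

lemma rep_carrier: "d \<in> D \<Longrightarrow> rep d H \<in> carrier G"
  using rep_D D_carrier by blast

lemma rep_mult: "d \<in> D \<Longrightarrow> e \<in> D \<Longrightarrow> rep d H \<otimes> rep e H = rep (d \<otimes> e) H"
  by (simp add: rep_def)

lemma rep_inv: "inv (rep d H) = rep (inv d) H"
  by (simp add: rep_def)

lemma familyI: "nontrivial_subgroup G H \<Longrightarrow> H #> rep d H \<in> family d"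
  unfolding family_def by blast

lemma family_subset: "d \<in> D \<Longrightarrow> family d \<subseteq> K1 G"
  using rep_carrier unfolding family_def K1_def by blast

lemma family_one: "family \<one> = idempotents (K1 G) (K1_mult G)"
proof -
  have "H #> rep \<one> H = H" if "nontrivial_subgroup G H" for H
    using coset_mult_one[OF nontrivial_subgroupD(2)[OF that]] by (simp add: rep_def)
  then show ?thesis unfolding family_def K1_idempotents by (metis (lifting))
qed

text \<open>If \<open>P\<close> separates \<open>M\<close> from \<open>H\<close> or \<open>K\<close>, then \<open>M\<close> contains \<open>D\<close> and absorbs every representative.\<close>

lemma rcos_rep_absorb:
  assumes H: "nontrivial_subgroup G H" and K: "nontrivial_subgroup G K" and M: "nontrivial_subgroup G M"
    and "H \<subseteq> M" "K \<subseteq> M" and d: "d \<in> D" and e: "e \<in> D"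
  shows "M #> (rep d H \<otimes> rep e K) = M #> rep (d \<otimes> e) M"
proof (cases "D \<subseteq> M")
  case True
  note sM = nontrivial_subgroupD(1)[OF M]
  have "rep d H \<otimes> rep e K \<in> D"
    using rep_D[OF d] rep_D[OF e] by (rule subgroup.m_closed[OF subgroup_D])
  moreover have "rep (d \<otimes> e) M \<in> D"
    using rep_D subgroup.m_closed[OF subgroup_D d e] by blast
  moreover have "M #> x = M" if "x \<in> D" for x
    using coset_join2[OF D_carrier[OF that] sM] that True by blast
  ultimately show ?thesis by simp
next
  case False
  then have "P H \<longleftrightarrow> P M" "P K \<longleftrightarrow> P M" using P_mono assms by blast+
  then have "rep d H = rep d M" "rep e K = rep e M" by (simp_all add: rep_def)
  then show ?thesis using rep_mult[OF d e] by simp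
qed

text \<open>In a product of Hx and Ky the subgroup K is replaced by its conjugate under x^-1, which
  has the same representative by \<open>P_conj\<close>. The generated subgroup lies above both
  factors, so \<open>rcos_rep_absorb\<close> identifies its coset.\<close>

lemma family_mult:
  assumes d: "d \<in> D" and e: "e \<in> D"
  shows "{K1_mult G x y | x y. x \<in> family d \<and> y \<in> family e} = family (d \<otimes> e)"
proof
  show "{K1_mult G x y | x y. x \<in> family d \<and> y \<in> family e} \<subseteq> family (d \<otimes> e)"
  proof clarify
    fix x y assume "x \<in> family d" "y \<in> family e"
    then obtain H K where H: "nontrivial_subgroup G H" "x = H #> rep d H"
      and K: "nontrivial_subgroup G K" "y = K #> rep e K" unfolding family_def by blast
    let ?K = "conj_set G K (inv (rep d H))"
    let ?M = "generate G (H \<union> ?K)"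
    have r: "inv (rep d H) \<in> D" using rep_D[OF d] by (rule subgroup.m_inv_closed[OF subgroup_D])
    have K': "nontrivial_subgroup G ?K" using conj_set_nontrivial[OF K(1) D_carrier[OF r]] .
    have "rep e K = rep e ?K" using P_conj[OF K(1) r] by (simp add: rep_def)
    then have "K1_mult G x y = ?M #> (rep d H \<otimes> rep e ?K)"
      unfolding H(2) K(2) using K1_mult_rcos[OF H(1) K(1) rep_carrier[OF d] rep_carrier[OF e]] by simp
    also have "\<dots> = ?M #> rep (d \<otimes> e) ?M"
      using K1_product_nontrivial[OF H(1) K(1) rep_carrier[OF d]]
      by (intro rcos_rep_absorb[OF H(1) K' _ _ _ d e]) (auto intro: generate.incl)
    finally show "K1_mult G x y \<in> family (d \<otimes> e)"
      using K1_product_nontrivial[OF H(1) K(1) rep_carrier[OF d]] familyI by simp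
  qed
  show "family (d \<otimes> e) \<subseteq> {K1_mult G x y | x y. x \<in> family d \<and> y \<in> family e}"
  proof
    fix z assume "z \<in> family (d \<otimes> e)"
    then obtain H where H: "nontrivial_subgroup G H" "z = H #> rep (d \<otimes> e) H"
      unfolding family_def by blast
    note H' = nontrivial_subgroupD[OF H(1)]
    \<comment> \<open>The conjugation in the product turns this subgroup back into H, so the
      subgroup generated is H itself.\<close>
    let ?K = "conj_set G H (rep d H)"
    have K: "nontrivial_subgroup G ?K" using conj_set_nontrivial[OF H(1) rep_carrier[OF d]] .
    have "conj_set G ?K (inv (rep d H)) = H"
      using conj_set_conj_set[OF H'(2) rep_carrier[OF d] inv_closed[OF rep_carrier[OF d]]]
        rep_carrier[OF d] conj_set_one[OF H'(2)] by simp
    moreover have "generate G H = H" using generateI[OF H'(1) subset_refl] by blast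
    moreover have "rep e ?K = rep e H" using P_conj[OF H(1) rep_D[OF d]] by (simp add: rep_def)
    ultimately have "K1_mult G (H #> rep d H) (?K #> rep e ?K) = z"
      using K1_mult_rcos[OF H(1) K rep_carrier[OF d] rep_carrier[OF e]] rep_mult[OF d e] H(2) by simp
    then show "z \<in> {K1_mult G x y | x y. x \<in> family d \<and> y \<in> family e}"
      using familyI[OF H(1)] familyI[OF K] by blast
  qed
qed

lemma family_inv:
  assumes d: "d \<in> D" and "x \<in> family d"
  shows "semigroup_inv (K1 G) (K1_mult G) x \<in> family (inv d)"
proof -
  obtain H where H: "nontrivial_subgroup G H" "x = H #> rep d H"
    using assms unfolding family_def by blast
  have "rep (inv d) (conj_set G H (rep d H)) = inv (rep d H)"
    using P_conj[OF H(1) rep_D[OF d]] unfolding rep_inv by (simp add: rep_def)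
  then show ?thesis
    using K1_semigroup_inv[OF H(1) rep_carrier[OF d]] H(2)
      familyI[OF conj_set_nontrivial[OF H(1) rep_carrier[OF d, of H]], where d = "inv d"] by simp
qed

text \<open>Compatibility holds because the products with inverses fall into
  \<open>family \<one>\<close>, the set of idempotents. For the order, a coset containing Kx has the
  form Hx with K inside H, and \<open>rcos_rep_absorb\<close> exchanges the representative of K for
  that of H.\<close>

lemma family_permissible:
  assumes d: "d \<in> D"
  shows "permissible (K1 G) (K1_mult G) (family d)"
  unfolding permissible_def
proof (intro conjI ballI impI)
  have di: "inv d \<in> D" using d by (rule subgroup.m_inv_closed[OF subgroup_D])
  show "family d \<subseteq> K1 G" using d by (rule family_subset)
  fix x y assume xy: "x \<in> family d" "y \<in> family d"
  have "K1_mult G x (semigroup_inv (K1 G) (K1_mult G) y) \<in> family (d \<otimes> inv d)"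
    using family_mult[OF d di] family_inv[OF d xy(2)] xy(1) by blast
  moreover have "K1_mult G (semigroup_inv (K1 G) (K1_mult G) x) y \<in> family (inv d \<otimes> d)"
    using family_mult[OF di d] family_inv[OF d xy(1)] xy(2) by blast
  ultimately show "compatible_elems (K1 G) (K1_mult G) x y"
    unfolding compatible_elems_def using family_one D_carrier[OF d] by simp
next
  fix y x assume y: "y \<in> family d" and x: "x \<in> K1 G" and "natural_le (K1 G) (K1_mult G) x y"
  then have yx: "y \<subseteq> x" using K1_natural_le[OF x] family_subset[OF d] by blast
  obtain K where K: "nontrivial_subgroup G K" "y = K #> rep d K"
    using y unfolding family_def by blast
  obtain H b where H: "nontrivial_subgroup G H" "subgroup H G" "b \<in> carrier G" "x = H #> b"
    using K1_E[OF x] by metis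
  have "rep d K \<in> y"
    unfolding K(2) by (rule rcos_self[OF rep_carrier[OF d] nontrivial_subgroupD(1)[OF K(1)]])
  then have xr: "x = H #> rep d K" using repr_independence[OF _ H(3,2)] yx H(4) by blast
  have "K \<subseteq> H"
  proof
    fix k assume k: "k \<in> K"
    have kc: "k \<in> carrier G" using k nontrivial_subgroupD(2)[OF K(1)] by blast
    have "k \<otimes> rep d K \<in> H #> rep d K" using k yx K(2) xr unfolding r_coset_def by blast
    then show "k \<in> H"
      using mem_rcos[OF subgroup.subset[OF H(2)] rep_carrier[OF d]] kc rep_carrier[OF d]
      by (simp add: m_assoc)
  qed
  then have "H #> (rep d K \<otimes> rep \<one> K) = H #> rep (d \<otimes> \<one>) H"
    using subgroup.one_closed[OF subgroup_D] by (intro rcos_rep_absorb[OF K(1) K(1) H(1) _ _ d])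
  moreover have "rep \<one> K = \<one>" by (simp add: rep_def)
  ultimately have "x = H #> rep d H" using xr rep_carrier[OF d] D_carrier[OF d] by simp
  then show "x \<in> family d" using familyI[OF H(1)] by simp
qed

lemma family_unit:
  assumes d: "d \<in> D"
  shows "family d \<in> carrier (completion_units (K1 G) (K1_mult G))"
proof -
  have di: "inv d \<in> D" using d by (rule subgroup.m_inv_closed[OF subgroup_D])
  show ?thesis
    unfolding completion_units_def units_of_def completion_def Units_def
    using family_permissible[OF d] family_permissible[OF di] family_mult[OF d di] family_mult[OF di d]
      family_one D_carrier[OF d]
    by (auto intro!: exI[of _ "family (inv d)"])
qed

end

section \<open>The map \<open>eta\<close> as a coset family\<close>

context group
begin

text \<open>For a constant predicate both conditions are trivial, so the general facts on coset
  families show that \<open>eta\<close> takes unit values and is multiplicative.\<close>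

lemma eta_coset_family: "coset_family G (carrier G) (\<lambda>_. True)"
  by unfold_locales (simp_all add: subgroup_self)

lemma eta_eq_family: "eta G a = coset_family.family G (\<lambda>_. True) a"
proof -
  interpret coset_family G "carrier G" "\<lambda>_. True" by (rule eta_coset_family)
  show ?thesis unfolding eta_def family_def rep_def by simp
qed

lemma eta_hom: "eta G \<in> hom G (completion_units (K1 G) (K1_mult G))"
proof (rule homI)
  interpret coset_family G "carrier G" "\<lambda>_. True" by (rule eta_coset_family)
  fix a b assume a: "a \<in> carrier G" and b: "b \<in> carrier G"
  show "eta G a \<in> carrier (completion_units (K1 G) (K1_mult G))"
    unfolding eta_eq_family by (rule family_unit[OF a])
  show "eta G (a \<otimes> b) = eta G a \<otimes>\<^bsub>completion_units (K1 G) (K1_mult G)\<^esub> eta G b"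
    unfolding eta_eq_family family_mult[OF a b, symmetric]
    by (simp add: completion_units_def units_of_def completion_def)
qed

text \<open>A coset determines its subgroup, so only the coset of H itself in \<open>eta G b\<close>
  can match.\<close>

lemma rcos_in_eta_iff:
  assumes "nontrivial_subgroup G H" "a \<in> carrier G" "b \<in> carrier G"
  shows "H #> a \<in> eta G b \<longleftrightarrow> a \<otimes> inv b \<in> H"
proof -
  have "H #> a \<in> eta G b \<longleftrightarrow> (\<exists>K. nontrivial_subgroup G K \<and> H #> a = K #> b)"
    unfolding eta_def by blast
  also have "\<dots> \<longleftrightarrow> a \<otimes> inv b \<in> H"
    using rcos_eq_iff[OF nontrivial_subgroupD(1)[OF assms(1)] nontrivial_subgroupD(1) assms(2,3)]
      assms(1) by blast
  finally show ?thesis .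
qed

lemma eta_inj:
  assumes "H \<in> minimal_subgroups G" "K \<in> minimal_subgroups G" "H \<noteq> K"
  shows "inj_on (eta G) (carrier G)"
proof (rule inj_onI)
  fix a b assume ab: "a \<in> carrier G" "b \<in> carrier G" and eq: "eta G a = eta G b"
  have mem: "a \<otimes> inv b \<in> L" if "L \<in> minimal_subgroups G" for L
  proof -
    have L: "nontrivial_subgroup G L" using that by (rule minimal_subgroupsD(1))
    have "L #> a \<in> eta G a"
      using rcos_in_eta_iff[OF L ab(1) ab(1)] nontrivial_subgroupD(3)[OF L] ab(1) by simp
    then show ?thesis using rcos_in_eta_iff[OF L ab] eq by simp
  qed
  have "a \<otimes> inv b = \<one>"
    using mem[OF assms(1)] mem[OF assms(2)] minimal_subgroups_disjoint[OF assms] by blast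
  then show "a = b" using ab by (metis inv_equality inv_inv inv_closed)
qed

section \<open>Units and the graph of minimal subgroups\<close>

text \<open>The product of (Ha)^-1 and Kb is a coset of the subgroup generated by the conjugates of
  H and K under a, with representative a^-1 b. Being idempotent, it is a subgroup and contains 1,
  which puts a^-1 b into the conjugate of L under a. Conjugating back gives the claim.\<close>

lemma compatible_rcosD:
  assumes H: "nontrivial_subgroup G H" and K: "nontrivial_subgroup G K"
    and a: "a \<in> carrier G" and b: "b \<in> carrier G"
    and L: "subgroup L G" "H \<subseteq> L" "K \<subseteq> L"
    and "compatible_elems (K1 G) (K1_mult G) (H #> a) (K #> b)"
  shows "b \<otimes> inv a \<in> L"
proof -
  have cH: "nontrivial_subgroup G (conj_set G H a)" by (rule conj_set_nontrivial[OF H a])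
  let ?M = "generate G (conj_set G H a \<union> conj_set G K a)"
  have M: "subgroup ?M G"
    using K1_product_nontrivial[OF cH K inv_closed[OF a]] a by (simp add: nontrivial_subgroup_def)
  have cL: "subgroup (conj_set G L a) G" by (rule conj_set_subgroup[OF L(1) a])
  have ab: "inv a \<otimes> b \<in> carrier G" using a b by simp
  have "K1_mult G (conj_set G H a #> inv a) (K #> b) \<in> idempotents (K1 G) (K1_mult G)"
    using assms(8) K1_semigroup_inv[OF H a] unfolding compatible_elems_def by simp
  then have "subgroup (?M #> (inv a \<otimes> b)) G"
    unfolding K1_idempotents K1_mult_rcos[OF cH K inv_closed[OF a] b] using a
    by (simp add: nontrivial_subgroup_def)
  then have "\<one> \<in> ?M #> (inv a \<otimes> b)" by (rule subgroup.one_closed)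
  then have "inv (inv a \<otimes> b) \<in> ?M" using mem_rcos[OF subgroup.subset[OF M] ab] ab by simp
  then have "inv (inv (inv a \<otimes> b)) \<in> ?M" by (rule subgroup.m_inv_closed[OF M])
  then have "inv a \<otimes> b \<in> ?M" using ab by simp
  also have "?M \<subseteq> conj_set G L a"
    using generate_subgroup_incl[OF _ cL] conj_set_mono L(2,3) by simp
  finally have "a \<otimes> (inv a \<otimes> b) \<otimes> inv a \<in> L"
    using mem_conj_set[OF subgroup.subset[OF L(1)] a] by simp
  then show ?thesis using a b by (simp add: cancel)
qed

text \<open>The natural order reverses inclusion, so an order ideal is closed under passing to
  larger cosets.\<close>

lemma permissible_rcos_upward:
  assumes A: "permissible (K1 G) (K1_mult G) A" and "K #> a \<in> A"
    and K: "nontrivial_subgroup G K" and H: "nontrivial_subgroup G H" and "K \<subseteq> H" and a: "a \<in> carrier G"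
  shows "H #> a \<in> A"
proof -
  have k: "K #> a \<in> K1 G" and h: "H #> a \<in> K1 G" using H K a unfolding K1_def by blast+
  have "K #> a \<subseteq> H #> a" using assms(5) unfolding r_coset_def by blast
  then show ?thesis using K1_natural_le[OF h k] A assms(2) h unfolding permissible_def by blast
qed

text \<open>The idempotent H is a product of some Ka in the unit with a coset in its inverse. The
  subgroup generated in this product is H, so K lies in H and Ka can be enlarged to Ha.\<close>

lemma unit_contains_rcos:
  assumes A: "A \<in> carrier (completion_units (K1 G) (K1_mult G))" and H: "nontrivial_subgroup G H"
  obtains a where "a \<in> carrier G" "H #> a \<in> A"
proof -
  have Ap: "permissible (K1 G) (K1_mult G) A"
    using A by (simp add: completion_units_def units_of_def completion_def Units_def)
  obtain B where B: "permissible (K1 G) (K1_mult G) B"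
    "{K1_mult G x y | x y. x \<in> A \<and> y \<in> B} = idempotents (K1 G) (K1_mult G)"
    using A by (auto simp: completion_units_def units_of_def completion_def Units_def)
  have "H \<in> {K1_mult G x y | x y. x \<in> A \<and> y \<in> B}" using H unfolding B(2) K1_idempotents by simp
  then obtain x y where xy: "x \<in> A" "y \<in> B" "H = K1_mult G x y" by blast
  have "x \<in> K1 G" "y \<in> K1 G" using xy Ap B(1) unfolding permissible_def by auto
  then obtain K a L b where K: "nontrivial_subgroup G K" "a \<in> carrier G" "x = K #> a"
    and L: "nontrivial_subgroup G L" "b \<in> carrier G" "y = L #> b" using K1_E by metis
  let ?M = "generate G (K \<union> conj_set G L (inv a))"
  have sM: "subgroup ?M G"
    using K1_product_nontrivial[OF K(1) L(1) K(2)] by (simp add: nontrivial_subgroup_def)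
  note sH = nontrivial_subgroupD[OF H]
  have "H #> \<one> = ?M #> (a \<otimes> b)"
    using xy(3) K1_mult_rcos[OF K(1) L(1) K(2) L(2)] K(3) L(3) sH(2) by (simp add: coset_mult_one)
  then have "H = ?M" using rcos_eq_iff[OF sH(1) sM one_closed] K(2) L(2) by blast
  then have "K \<subseteq> H" by (auto intro: generate.incl)
  then have "H #> a \<in> A" using permissible_rcos_upward[OF Ap _ K(1) H _ K(2)] xy(1) K(3) by simp
  with K(2) show thesis by (rule that)
qed

end

text \<open>Infinite sets have \<open>card\<close> 0, so the left side means exactly one component.
  Both sides exclude the empty graph.\<close>

lemma (in wf_digraph) card_sccs_eq_1_iff:
  "card sccs = 1 \<longleftrightarrow> strongly_connected G"
proof
  assume "card sccs = 1"
  then have "card (scc_of ` verts G) = 1"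
    using card_sccs_verts sccs_verts_conv_scc_of by simp
  then obtain S where S: "scc_of ` verts G = {S}" by (rule card_1_singletonE)
  have "u \<rightarrow>\<^sup>* v" if "u \<in> verts G" "v \<in> verts G" for u v
  proof -
    have "scc_of u = scc_of v" using that S by blast
    then have "v \<in> scc_of u" using in_scc_of_self that by simp
    then show ?thesis unfolding scc_of_def by blast
  qed
  then show "strongly_connected G" using S unfolding strongly_connected_def by blast
next
  assume "strongly_connected G"
  then show "card sccs = 1" unfolding strongly_connected_eq_iff by simp
qed

section \<open>Surjectivity of \<open>eta\<close> and connectedness of the graph\<close>

context group
begin

text \<open>
  With \<open>H\<^sub>r r \<in> A\<close>, compatibility gives \<open>H\<^sub>i a\<^sub>i r \<in> A\<close> with \<open>a\<^sub>i \<in> H\<^sub>r\<close>, and \<open>a\<^sub>i a\<^sub>j\<^sup>-\<^sup>1\<close> lies in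
  \<open>H\<^sub>i H\<^sub>j \<inter> H\<^sub>r = 1\<close> for adjacent \<open>H\<^sub>i\<close> and \<open>H\<^sub>j\<close>; so \<open>a\<^sub>i\<close> is constant on components.
\<close>

lemma unit_in_range_eta:
  assumes per: "periodic_group G"
    and perm: "\<forall>H\<in>minimal_subgroups G. \<forall>K\<in>minimal_subgroups G. H <#> K = K <#> H"
    and Hr: "Hr \<in> minimal_subgroups G"
    and conn: "strongly_connected (with_proj (minsub_graph G Hr))"
    and A: "A \<in> carrier (completion_units (K1 G) (K1_mult G))"
  shows "A \<in> eta G ` carrier G"
proof -
  let ?\<Gamma> = "with_proj (minsub_graph G Hr)"
  interpret \<Gamma>: pair_bidirected_digraph "minsub_graph G Hr" by (rule minsub_graph_symmetric[OF perm])
  note nt = minimal_subgroupsD(1)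
  note sg = nontrivial_subgroupD(1)[OF nt]
  have Ap: "permissible (K1 G) (K1_mult G) A"
    using A by (simp add: completion_units_def units_of_def completion_def Units_def)
  have compat: "b \<otimes> inv a \<in> L"
    if "nontrivial_subgroup G H" "nontrivial_subgroup G K" "a \<in> carrier G" "b \<in> carrier G"
      "subgroup L G" "H \<subseteq> L" "K \<subseteq> L" "H #> a \<in> A" "K #> b \<in> A" for H K L a b
    using compatible_rcosD[OF that(1-7)] Ap that(8,9) unfolding permissible_def by blast
  obtain r where r: "r \<in> carrier G" "Hr #> r \<in> A" by (rule unit_contains_rcos[OF A nt[OF Hr]])
  have ex: "\<exists>a\<in>Hr. H #> (a \<otimes> r) \<in> A" if H: "H \<in> minimal_subgroups G" for H
  proof -
    obtain b where b: "b \<in> carrier G" "H #> b \<in> A" by (rule unit_contains_rcos[OF A nt[OF H]])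
    have M: "subgroup (H <#> Hr) G" using set_mult_subgroup[OF sg[OF H] sg[OF Hr]] perm H Hr by blast
    have "b \<otimes> inv r \<in> H <#> Hr"
      using subset_set_mult[OF sg[OF H] sg[OF Hr]] b r
      by (intro compat[OF nt[OF Hr] nt[OF H] _ _ M])
    then obtain h a where ha: "h \<in> H" "a \<in> Hr" "b \<otimes> inv r = h \<otimes> a" unfolding set_mult_def by blast
    have c: "h \<in> carrier G" "a \<in> carrier G"
      using ha nontrivial_subgroupD(2)[OF nt] H Hr by blast+
    \<comment> \<open>The factor h is absorbed by H, so the representative b may be replaced by
      \<open>a \<otimes> r\<close>.\<close>
    have "b = h \<otimes> (a \<otimes> r)" using ha(3) c b(1) r(1) by (metis inv_solve_right m_assoc m_closed)
    then have "b \<in> H #> (a \<otimes> r)" using ha(1) unfolding r_coset_def by blast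
    then have "H #> (a \<otimes> r) = H #> b"
      using repr_independence[OF _ _ sg[OF H]] c r(1) by simp
    then have "H #> (a \<otimes> r) \<in> A" using b(2) by simp
    then show ?thesis using ha(2) by blast
  qed
  have Hrc: "Hr \<subseteq> carrier G" using nontrivial_subgroupD(2)[OF nt[OF Hr]] .
  obtain H0 where "H0 \<in> verts ?\<Gamma>" using conn unfolding strongly_connected_def by blast
  then have H0: "H0 \<in> minimal_subgroups G" "H0 \<in> verts ?\<Gamma>" by (auto simp: minsub_graph_def)
  obtain a where a: "a \<in> Hr" "H0 #> (a \<otimes> r) \<in> A" using ex[OF H0(1)] by blast
  have ac: "a \<in> carrier G" using a Hrc by blast
  define g where "g = a \<otimes> r"
  have gc: "g \<in> carrier G" using ac r(1) by (simp add: g_def)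
  have on_graph: "K #> g \<in> A" if "K \<in> verts ?\<Gamma>" for K
  proof -
    have "H0 \<rightarrow>\<^sup>*\<^bsub>?\<Gamma>\<^esub> K" using conn H0(2) that unfolding strongly_connected_def by blast
    then show ?thesis
    proof (induct rule: \<Gamma>.reachable_induct)
      case base
      show ?case using a(2) by (simp add: g_def)
    next
      case (step K L)
      then have KL: "K \<in> minimal_subgroups G" "L \<in> minimal_subgroups G" "(K <#> L) \<inter> Hr = {\<one>}"
        by (auto simp: minsub_graph_def)
      obtain b where b: "b \<in> Hr" "L #> (b \<otimes> r) \<in> A" using ex[OF KL(2)] by blast
      have bc: "b \<in> carrier G" using b Hrc by blast
      have M: "subgroup (K <#> L) G" using set_mult_subgroup[OF sg sg] KL(1,2) perm by blast
      have "(b \<otimes> r) \<otimes> inv g \<in> K <#> L"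
        using subset_set_mult[OF sg[OF KL(1)] sg[OF KL(2)]] b r bc gc step(3)
        by (intro compat[OF nt[OF KL(1)] nt[OF KL(2)] _ _ M]) auto
      moreover have "(b \<otimes> r) \<otimes> inv g = b \<otimes> inv a"
        using ac bc r(1) by (simp add: g_def inv_mult_group m_assoc cancel)
      moreover have "b \<otimes> inv a \<in> Hr"
        using a(1) b(1) subgroup.m_closed[OF sg[OF Hr]] subgroup.m_inv_closed[OF sg[OF Hr]] by blast
      ultimately have "b \<otimes> inv a = \<one>" using KL(3) by auto
      then have "b = a" using ac bc by (metis inv_equality inv_inv inv_closed)
      then show ?case using b(2) by (simp add: g_def)
    qed
  qed
  \<comment> \<open>As a lies in Hr, the common representative g also serves Hr, which is not a
    vertex of the graph.\<close>
  have "Hr #> g = Hr #> r"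
    using coset_mult_assoc[OF Hrc ac r(1)] coset_join2[OF ac sg[OF Hr] a(1)] by (simp add: g_def)
  then have minimal: "K #> g \<in> A" if "K \<in> minimal_subgroups G" for K
    using that r(2) on_graph by (cases "K = Hr") (auto simp: minsub_graph_def)
  have all: "K #> g \<in> A" if K: "nontrivial_subgroup G K" for K
  proof -
    obtain H where "H \<in> minimal_subgroups G" "H \<subseteq> K"
      by (rule periodic_minimal_subgroup_exists[OF per K])
    then show ?thesis using permissible_rcos_upward[OF Ap minimal nt K _ gc] by blast
  qed
  \<comment> \<open>Nothing else is in A: a coset Kb in A is compatible with Kg, and this forces Kb
    = Kg.\<close>
  have "x \<in> eta G g" if "x \<in> A" for x
  proof -
    have "x \<in> K1 G" using that Ap unfolding permissible_def by blast
    then obtain K b where K: "nontrivial_subgroup G K" "subgroup K G" "b \<in> carrier G" "x = K #> b"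
      using K1_E by metis
    have "b \<otimes> inv g \<in> K"
      by (rule compat[OF K(1) K(1) gc K(3) K(2) subset_refl subset_refl all[OF K(1)]])
        (use K(4) that in simp)
    then show ?thesis using rcos_in_eta_iff[OF K(1,3) gc] K(4) by simp
  qed
  moreover have "eta G g \<subseteq> A" using all unfolding eta_def by blast
  ultimately have "A = eta G g" by blast
  then show ?thesis using gc by blast
qed

text \<open>
  For a union \<open>C\<close> of components the coset family with \<open>d \<noteq> 1\<close> in \<open>H\<^sub>r\<close> on the subgroups that lie
  over \<open>C\<close> but not over \<open>H\<^sub>r\<close> is a unit. It is not in the image of \<open>\<eta>\<close> if \<open>C\<close> is proper.
\<close>

lemma connected_if_eta_surj:
  assumes per: "periodic_group G"
    and perm: "\<forall>H\<in>minimal_subgroups G. \<forall>K\<in>minimal_subgroups G. H <#> K = K <#> H"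
    and Hr: "Hr \<in> minimal_subgroups G"
    and surj: "carrier (completion_units (K1 G) (K1_mult G)) \<subseteq> eta G ` carrier G"
    and H0: "H0 \<in> verts (with_proj (minsub_graph G Hr))"
    and K0: "K0 \<in> verts (with_proj (minsub_graph G Hr))"
  shows "H0 \<rightarrow>\<^sup>*\<^bsub>with_proj (minsub_graph G Hr)\<^esub> K0"
proof (rule ccontr)
  let ?\<Gamma> = "with_proj (minsub_graph G Hr)"
  interpret \<Gamma>: pair_bidirected_digraph "minsub_graph G Hr" by (rule minsub_graph_symmetric[OF perm])
  assume unreachable: "\<not> H0 \<rightarrow>\<^sup>*\<^bsub>?\<Gamma>\<^esub> K0"
  note nt = minimal_subgroupsD(1)
  note sg = nontrivial_subgroupD(1)[OF nt]
  define C where "C = {K. H0 \<rightarrow>\<^sup>*\<^bsub>?\<Gamma>\<^esub> K}"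
  have C: "K \<in> minimal_subgroups G" "K \<noteq> Hr" if "K \<in> C" for K
  proof -
    have "H0 \<rightarrow>\<^sup>*\<^bsub>?\<Gamma>\<^esub> K" using that by (simp add: C_def)
    then have "K \<in> pverts (minsub_graph G Hr)" by (rule \<Gamma>.reachable_in_verts(2))
    then show "K \<in> minimal_subgroups G" "K \<noteq> Hr" by (simp_all add: minsub_graph_def)
  qed
  \<comment> \<open>A subgroup M not containing Hr meets it trivially by minimality. So KL, which
    lies in M, does too, and distinct K and L are adjacent.\<close>
  have C_closed: "L \<in> C"
    if "K \<in> C" "L \<in> minimal_subgroups G" "subgroup M G" "K \<subseteq> M" "L \<subseteq> M" "\<not> Hr \<subseteq> M" for K L M
  proof (cases "K = L")
    case False
    have "L \<noteq> Hr" using that(5,6) by blast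
    have "K <#> L \<subseteq> M" using that(3-5) unfolding set_mult_def by (auto intro: subgroup.m_closed)
    then have "(K <#> L) \<inter> Hr \<subseteq> {\<one>}"
      using minimal_subgroup_le[OF Hr that(3)] that(6) by blast
    moreover have "\<one> \<in> (K <#> L) \<inter> Hr"
      using subset_set_mult(1)[OF sg[OF C(1)[OF that(1)]] sg[OF that(2)]]
        nontrivial_subgroupD(3)[OF nt[OF C(1)[OF that(1)]]] nontrivial_subgroupD(3)[OF nt[OF Hr]] by blast
    ultimately have "(K <#> L) \<inter> Hr = {\<one>}" by blast
    then have "(K, L) \<in> parcs (minsub_graph G Hr)"
      using False C[OF that(1)] that(2) \<open>L \<noteq> Hr\<close> unfolding minsub_graph_def by simp
    with that(1) have "H0 \<rightarrow>\<^sup>*\<^bsub>?\<Gamma>\<^esub> L"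
      unfolding C_def mem_Collect_eq by (rule \<Gamma>.reachable_adj_trans)
    then show ?thesis by (simp add: C_def)
  qed (use that in simp)
  define P where "P H \<longleftrightarrow> \<not> Hr \<subseteq> H \<and> (\<exists>K\<in>C. K \<subseteq> H)" for H
  interpret coset_family G Hr P
  proof (intro coset_family.intro coset_family_axioms.intro)
    show "group G" by (rule group_axioms)
    show "subgroup Hr G" by (rule sg[OF Hr])
    have norm: "conj_set G K d = K" if "K \<in> minimal_subgroups G" "d \<in> Hr" for K d
      by (rule minimal_subgroup_normalizes[OF perm Hr that])
    \<comment> \<open>Since d normalizes K, conjugating H by d does not change which minimal
      subgroups it contains.\<close>
    have le: "K \<subseteq> conj_set G H d \<longleftrightarrow> K \<subseteq> H"
      if H: "nontrivial_subgroup G H" and d: "d \<in> Hr" and K: "K \<in> minimal_subgroups G" for H K d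
    proof
      have dc: "d \<in> carrier G" using d nontrivial_subgroupD(2)[OF nt[OF Hr]] by blast
      have di: "inv d \<in> Hr" using d by (rule subgroup.m_inv_closed[OF sg[OF Hr]])
      show "K \<subseteq> conj_set G H d" if "K \<subseteq> H" using conj_set_mono[OF that] norm[OF K d] by metis
      assume "K \<subseteq> conj_set G H d"
      then have "conj_set G K (inv d) \<subseteq> conj_set G (conj_set G H d) (inv d)" by (rule conj_set_mono)
      then show "K \<subseteq> H"
        using norm[OF K di] nontrivial_subgroupD(2)[OF H] dc
        by (simp add: conj_set_conj_set conj_set_one)
    qed
    show "P (conj_set G H d) \<longleftrightarrow> P H" if "nontrivial_subgroup G H" "d \<in> Hr" for H d
      unfolding P_def using le[OF that] C(1) Hr by blast
    show "Hr \<subseteq> M \<or> (P H \<longleftrightarrow> P M)"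
      if H: "nontrivial_subgroup G H" and M: "nontrivial_subgroup G M" and "H \<subseteq> M" for H M
    proof -
      \<comment> \<open>If M lies over C but not over Hr, \<open>C_closed\<close> puts L into C, so
        H lies over C as well.\<close>
      obtain L where L: "L \<in> minimal_subgroups G" "L \<subseteq> H"
        by (rule periodic_minimal_subgroup_exists[OF per H])
      show ?thesis
        unfolding P_def using C_closed[OF _ L(1) nontrivial_subgroupD(1)[OF M]] L(2) that(3) by blast
    qed
  qed
  obtain d where d: "d \<in> Hr" "d \<noteq> \<one>"
    using nt[OF Hr] nontrivial_subgroupD(3)[OF nt[OF Hr]] unfolding nontrivial_subgroup_def by blast
  then have dc: "d \<in> carrier G" using D_carrier by blast
  obtain b where b: "b \<in> carrier G" "family d = eta G b"
    using family_unit[OF d(1)] surj by blast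
  have mem: "rep d H \<otimes> inv b \<in> H" if H: "H \<in> minimal_subgroups G" for H
    using rcos_in_eta_iff[OF nt[OF H] rep_carrier[OF d(1)] b(1)] familyI[OF nt[OF H]] b(2) by blast
  have min0: "H0 \<in> minimal_subgroups G" "H0 \<noteq> Hr" "K0 \<in> minimal_subgroups G" "K0 \<noteq> Hr"
    using H0 K0 by (auto simp: minsub_graph_def)
  have "H0 \<in> C" using H0 \<Gamma>.reachable_refl unfolding C_def by simp
  moreover have "K0 \<notin> C" using unreachable unfolding C_def by simp
  moreover have "\<not> Hr \<subseteq> H0" "\<not> Hr \<subseteq> K0"
    using minimal_subgroupsD(2)[OF _ nt[OF Hr]] min0 by blast+
  \<comment> \<open>These three subgroups suffice: representative 1 at K0 and Hr forces b = 1, and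
    representative d at H0 then puts d into H0.\<close>
  ultimately have "P H0" "\<not> P K0" "\<not> P Hr"
    unfolding P_def using C(1) minimal_subgroupsD(2)[OF min0(3) nt] by blast+
  then have inv: "inv b \<in> K0" "inv b \<in> Hr" "d \<otimes> inv b \<in> H0"
    using mem[OF min0(3)] mem[OF Hr] mem[OF min0(1)] b(1) by (simp_all add: rep_def)
  then have "inv b = \<one>" using minimal_subgroups_disjoint[OF min0(3) Hr min0(4)] by blast
  then have "d \<in> H0" using inv(3) dc by simp
  then show False using minimal_subgroups_disjoint[OF min0(1) Hr min0(2)] d by blast
qed

end

theorem lemma4p2:
  fixes G :: "('a, 'b) monoid_scheme" (structure) and Hr :: "'a set"
  assumes "periodic_group G"
    and "\<forall>H\<in>minimal_subgroups G. \<forall>K\<in>minimal_subgroups G. H <#> K = K <#> H"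
    and "infinite (minimal_subgroups G) \<or> card (minimal_subgroups G) \<ge> 2"
    and "Hr \<in> minimal_subgroups G"
  shows "eta G \<in> iso G (completion_units (K1 G) (K1_mult G))
    \<longleftrightarrow> card (connected_components (minsub_graph G Hr)) = 1"
proof -
  interpret group G using assms(1) by (simp add: periodic_group_def)
  let ?\<Gamma> = "with_proj (minsub_graph G Hr)"
  interpret \<Gamma>: pair_bidirected_digraph "minsub_graph G Hr"
    by (rule minsub_graph_symmetric[OF assms(2)])
  have "\<not> minimal_subgroups G \<subseteq> {Hr}"
  proof
    assume "minimal_subgroups G \<subseteq> {Hr}"
    then have "finite (minimal_subgroups G)" "card (minimal_subgroups G) \<le> 1"
      using finite_subset card_mono[of "{Hr}"] by auto
    then show False using assms(3) by simp
  qed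
  \<comment> \<open>This K serves twice: it is a vertex of the graph, and together with Hr it gives
    injectivity of \<open>eta\<close>.\<close>
  then obtain K where K: "K \<in> minimal_subgroups G" "K \<noteq> Hr" by blast
  then have verts: "verts ?\<Gamma> \<noteq> {}" by (auto simp: minsub_graph_def)
  have "card (connected_components (minsub_graph G Hr)) = 1 \<longleftrightarrow> strongly_connected ?\<Gamma>"
    unfolding connected_components_def by (rule \<Gamma>.card_sccs_eq_1_iff)
  also have "\<dots> \<longleftrightarrow> carrier (completion_units (K1 G) (K1_mult G)) \<subseteq> eta G ` carrier G"
    using unit_in_range_eta[OF assms(1,2,4)] connected_if_eta_surj[OF assms(1,2,4)] verts
    unfolding strongly_connected_def by blast
  also have "\<dots> \<longleftrightarrow> eta G \<in> iso G (completion_units (K1 G) (K1_mult G))"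
    using eta_hom eta_inj[OF K(1) assms(4) K(2)]
    unfolding iso_def bij_betw_def hom_def by blast
  finally show ?thesis by simp
qed

end
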